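(* Let $z\in\mathbb C\setminus[-1,1]$, $\gamma,\alpha\in\mathbb C$, $\alpha+\gamma\notin-\mathbb N$. Then $$Q_{2\gamma}^{(\alpha,\alpha)}(z)=\frac{\sqrt\pi\,\Gamma(\alpha+2\gamma+1)}{2^{2\gamma}\Gamma(\gamma+\frac12)\Gamma(\alpha+\gamma+1)}\,Q_\gamma^{(\alpha,-\frac12)}(2z^2-1),$$ where $\alpha+2\gamma\notin-\mathbb N$, $\gamma\notin-\mathbb N+\tfrac12$, and $$Q_{2\gamma+1}^{(\alpha,\alpha)}(z)=\frac{\sqrt\pi\,\Gamma(\alpha+2\gamma+2)\,z}{2^{2\gamma+1}\Gamma(\gamma+\frac32)\Gamma(\alpha+\gamma+1)}\,Q_\gamma^{(\alpha,\frac12)}(2z^2-1),$$ where $\alpha+2\gamma+1\notin-\mathbb N$, $\gamma\notin-\mathbb N-\tfrac12$.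
   Context: $\mathbb N=\{1,2,3,\dots\}$; $(a)_n=a(a+1)\cdots(a+n-1)$. ${}_2\mathbf F_1(a,b;c;z)=\sum_{k\ge0}\frac{(a)_k(b)_k}{\Gamma(c+k)}\frac{z^k}{k!}$ ($|z|<1$, and elsewhere by analytic continuation) is the Olver normalized Gauss hypergeometric function. Jacobi function of the second kind ($z\in\mathbb C\setminus[-1,1]$, $\alpha+\gamma,\beta+\gamma\notin-\mathbb N$): $Q_\gamma^{(\alpha,\beta)}(z)=\frac{2^{\alpha+\beta+\gamma}\Gamma(\alpha+\gamma+1)\Gamma(\beta+\gamma+1)}{(z-1)^{\alpha+\gamma+1}(z+1)^\beta}{}_2\mathbf F_1\bigl(\gamma+1,\alpha+\gamma+1;\alpha+\beta+2\gamma+2;\tfrac2{1-z}\bigr)$.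
   Formalization: With principal powers the identities fail for Re z<0 (α=γ=0, z=-2: left side is odd in z, right side even); they are proved with principal powers for Re z>0 or z on the positive imaginary axis, and for all z outside [-1,1] with the powers at 2z²-1 continued analytically along with those at z. *)

theory Defs
  imports "HOL-Complex_Analysis.Complex_Analysis"
begin

text \<open>
  The Olver-normalized Gauss function on its principal sheet: the holomorphic continuation of the
  series from the unit disc to the plane cut along $[1,\infty)$. The cut plane is connected, so
  there is at most one such continuation and the choice operator does not introduce
  any freedom there. Using \<open>rGamma\<close> $= 1/\Gamma$ makes the series meaningful
  for every complex \<open>c\<close>.
\<close>

definition hyp2F1_olver :: "complex \<Rightarrow> complex \<Rightarrow> complex \<Rightarrow> complex \<Rightarrow> complex" where
  "hyp2F1_olver a b c =
     (SOME F. F holomorphic_on - (complex_of_real ` {1..}) \<and>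
        (\<forall>z. norm z < 1 \<longrightarrow>
           (\<lambda>k. pochhammer a k * pochhammer b k * rGamma (c + of_nat k) * (z ^ k / fact k))
             sums F z))"

text \<open>
  The Jacobi function of the second kind with principal values of all powers.
\<close>

definition jacobi_Q :: "complex \<Rightarrow> complex \<Rightarrow> complex \<Rightarrow> complex \<Rightarrow> complex" where
  "jacobi_Q \<gamma> \<alpha> \<beta> z =
     2 powr (\<alpha> + \<beta> + \<gamma>) * Gamma (\<alpha> + \<gamma> + 1) * Gamma (\<beta> + \<gamma> + 1) /
     ((z - 1) powr (\<alpha> + \<gamma> + 1) * (z + 1) powr \<beta>) *
     hyp2F1_olver (\<gamma> + 1) (\<alpha> + \<gamma> + 1) (\<alpha> + \<beta> + 2 * \<gamma> + 2) (2 / (1 - z))"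

text \<open>
  On $\mathbb C\setminus[-1,1]$ the function is in general multivalued, because of the powers of
  \<open>z - 1\<close> and \<open>z + 1\<close>. A branch is
  determined by a value \<open>l\<close> of $\log(z-1)$: the pairs \<open>(z, l)\<close> with \<open>exp l = z - 1\<close> form the
  universal cover of $\mathbb C\setminus[-1,1]$. Since \<open>(z + 1) / (z - 1)\<close> avoids
  $(-\infty,0]$ there, \<open>log_succ l z\<close> continues $\log(z+1)$ analytically along with \<open>l\<close>,
  with $\log(z+1)-\log(z-1)\to0$ at infinity.
\<close>

definition log_succ :: "complex \<Rightarrow> complex \<Rightarrow> complex" where
  "log_succ l z = l + Ln ((z + 1) / (z - 1))"

definition jacobi_Q_at :: "complex \<Rightarrow> complex \<Rightarrow> complex \<Rightarrow> complex \<Rightarrow> complex \<Rightarrow> complex" where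
  "jacobi_Q_at l \<gamma> \<alpha> \<beta> z =
     2 powr (\<alpha> + \<beta> + \<gamma>) * Gamma (\<alpha> + \<gamma> + 1) * Gamma (\<beta> + \<gamma> + 1) /
     (exp ((\<alpha> + \<gamma> + 1) * l) * exp (\<beta> * log_succ l z)) *
     hyp2F1_olver (\<gamma> + 1) (\<alpha> + \<gamma> + 1) (\<alpha> + \<beta> + 2 * \<gamma> + 2) (2 / (1 - z))"

text \<open>
  The lift of \<open>z \<mapsto> w = 2 * z\<^sup>2 - 1\<close> to the covers, from
  $w-1=2(z-1)(z+1)$. It is needed because a function of \<open>w\<close> with principal powers only depends
  on \<open>z\<^sup>2\<close>, so relations between principal values at \<open>z\<close> and \<open>w\<close> are confined to
  \<open>Re z > 0\<close> and the positive imaginary axis.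
\<close>

definition lift_quad :: "complex \<Rightarrow> complex \<Rightarrow> complex" where
  "lift_quad l z = Ln 2 + l + log_succ l z"

lemma not_in_cut_neq:
  assumes "z \<notin> closed_segment (-1) (1 :: complex)"
  shows "z \<noteq> 1" "z \<noteq> -1"
  using assms by auto

lemma exp_log_succ:
  assumes "z \<notin> closed_segment (-1) (1 :: complex)" "exp l = z - 1"
  shows "exp (log_succ l z) = z + 1"
proof -
  have "z - 1 \<noteq> 0" "z + 1 \<noteq> 0"
    using not_in_cut_neq[OF assms(1)] by (auto simp: add_eq_0_iff2)
  then show ?thesis
    by (simp add: log_succ_def exp_add assms(2))
qed

lemma exp_lift_quad:
  assumes "z \<notin> closed_segment (-1) (1 :: complex)" "exp l = z - 1"
  shows "exp (lift_quad l z) = (2 * z\<^sup>2 - 1) - 1"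
  by (simp add: lift_quad_def exp_add exp_log_succ[OF assms] assms(2))
     (simp add: algebra_simps power2_eq_square)

text \<open>The principal values are the branch given by the principal logarithm.\<close>

lemma log_succ_Ln:
  assumes "z \<notin> closed_segment (-1) (1 :: complex)"
  shows "log_succ (Ln (z - 1)) z = Ln (z + 1)"
proof -
  have nz: "z - 1 \<noteq> 0" "z + 1 \<noteq> 0"
    using not_in_cut_neq[OF assms] by (auto simp: add_eq_0_iff2)
  define d where "d = Ln (z + 1) - Ln (z - 1)"
  have "- pi < Im d \<and> Im d < pi"
  proof (cases "Im z" "0 :: real" rule: linorder_cases)
    case greater
    then show ?thesis
      using Im_Ln_pos_lt_imp[of "z + 1"] Im_Ln_pos_lt_imp[of "z - 1"] by (auto simp: d_def)
  next
    case less
    have "Im (Ln (z + 1)) < 0" "Im (Ln (z - 1)) < 0"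
      using less Im_Ln_pos_le[of "z + 1"] Im_Ln_pos_le[of "z - 1"]
        Im_Ln_le_pi[of "z + 1"] Im_Ln_le_pi[of "z - 1"] nz by auto
    then show ?thesis
      using mpi_less_Im_Ln[of "z + 1"] mpi_less_Im_Ln[of "z - 1"] nz by (auto simp: d_def)
  next
    case equal
    then have z: "z = of_real (Re z)"
      by (simp add: complex_eq_iff)
    have "\<not> (-1 \<le> Re z \<and> Re z \<le> 1)"
    proof
      assume "-1 \<le> Re z \<and> Re z \<le> 1"
      then have "z = (1 - (Re z + 1) / 2) *\<^sub>R (-1) + ((Re z + 1) / 2) *\<^sub>R 1"
          "0 \<le> (Re z + 1) / 2" "(Re z + 1) / 2 \<le> 1"
        using equal by (auto simp: complex_eq_iff field_simps)
      then show False
        using assms unfolding closed_segment_def by blast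
    qed
    then consider "Re z < -1" | "Re z > 1"
      by linarith
    then show ?thesis
    proof cases
      case 1
      then have "Im (Ln (z + 1)) = pi" "Im (Ln (z - 1)) = pi"
        using equal nz by (auto simp: Im_Ln_eq_pi)
      then show ?thesis by (simp add: d_def)
    next
      case 2
      then have "Im (Ln (z + 1)) = 0" "Im (Ln (z - 1)) = 0"
        using equal nz by (auto simp: Im_Ln_eq_0)
      then show ?thesis by (simp add: d_def)
    qed
  qed
  moreover have "exp d = (z + 1) / (z - 1)"
    using nz by (simp add: d_def exp_diff)
  ultimately have "Ln ((z + 1) / (z - 1)) = d"
    by (intro Ln_unique) auto
  then show ?thesis
    by (simp add: log_succ_def d_def)
qed

lemma jacobi_Q_at_Ln:
  assumes "z \<notin> closed_segment (-1) (1 :: complex)"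
  shows "jacobi_Q_at (Ln (z - 1)) \<gamma> \<alpha> \<beta> z = jacobi_Q \<gamma> \<alpha> \<beta> z"
  using not_in_cut_neq[OF assms]
  by (simp add: jacobi_Q_at_def jacobi_Q_def log_succ_Ln[OF assms] powr_def add_eq_0_iff2)

end

theory Submission
  imports Defs
begin

text \<open>
  Put $\zeta=2/(1-z)$, $w=2z^2-1$ and $\xi=2/(1-w)=1/(1-z^2)$, so that $\xi=-\zeta^2/(4(1-\zeta))$.
  Up to powers of $z\pm1$, the two sides of the claim are hypergeometric functions at $\zeta$ and
  at $\xi$, and they are related by Gauss's quadratic transformation
  $${}_2\mathbf F_1(2p,b;2b;\zeta)=\sqrt\pi\,\frac{2^{1-2b}}{\Gamma(b)}\,(1-\zeta)^{-p}\,
    {}_2\mathbf F_1\bigl(p,b-p;b+\tfrac12;\xi\bigr),$$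
  which is \<open>hyp2F1_olver_quadratic_double\<close>. For the odd formula $p=\gamma+1$ and
  $b=\alpha+2\gamma+2$ already give the right parameters at $\xi$. For the even formula
  $p=\gamma+\frac12$ and $b=\alpha+2\gamma+1$ give parameters that differ from the right ones by
  Euler's transformation, \<open>hyp2F1_olver_euler\<close>, with factor $(1-\xi)^{-1/2}$. The rest is
  bookkeeping of powers: all of them are exponentials of linear combinations of the chosen
  logarithms, and the factor $z$ of the odd formula comes from
  $\sqrt{z-1}\sqrt{z+1}\sqrt{(w+1)/(w-1)}=z$ (\<open>exp_half_log_sum\<close>).

  Both transformations hold coefficientwise near $0$, and each coefficient identity is an instance of
  the Pfaff--Saalschuetz sum (\<open>pfaff_saalschuetz\<close>). Written without divisions, that sum is a
  polynomial identity; since $1/\Gamma(c+k)=(c+k)_{n-k}/\Gamma(c+n)$, it applies to the Olver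
  normalization for every value of the lower parameter, including non-positive integers.

  Passing from coefficients to functions needs more than the identity theorem: the choice in the
  definition of \<open>hyp2F1_olver\<close> is meaningful only once some continuation to the cut plane is known
  to exist. For lower parameter $a+b+\frac12$ it is written down explicitly. The map
  $s\mapsto-4s/(1-s)^2$ takes the unit disc conformally onto the cut plane, and a third instance of
  the Pfaff--Saalschuetz sum shows that in the variable $s$ the series becomes
  $(1-s)^{2a}$ times a Gauss series, which converges on the whole disc
  (\<open>gauss_continuation_exists\<close>). The other two functions are then continued by the very
  transformations that relate them to this one.
\<close>

section \<open>The Pfaff--Saalschuetz sum\<close>

text \<open>
  Pascal's rule inside a sum of terms that depend on both $k$ and $n-k$.
\<close>

lemma sum_binomial_Suc:
  fixes g :: "nat \<Rightarrow> nat \<Rightarrow> 'a::comm_ring_1"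
  shows "(\<Sum>k\<le>Suc n. of_nat (Suc n choose k) * g k (Suc n - k)) =
         (\<Sum>k\<le>n. of_nat (n choose k) * (g k (Suc (n - k)) + g (Suc k) (n - k)))"
proof -
  have z: "(of_nat (n choose Suc n) :: 'a) = 0"
    by (subst binomial_eq_0) simp_all
  have "(\<Sum>k\<le>Suc n. of_nat (Suc n choose k) * g k (Suc n - k)) =
        g 0 (Suc n) + (\<Sum>k\<le>n. of_nat (n choose Suc k) * g (Suc k) (Suc n - Suc k)) +
        (\<Sum>k\<le>n. of_nat (n choose k) * g (Suc k) (n - k))"
    by (subst sum.atMost_Suc_shift) (simp add: sum.distrib algebra_simps)
  also have "g 0 (Suc n) + (\<Sum>k\<le>n. of_nat (n choose Suc k) * g (Suc k) (Suc n - Suc k)) =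
             (\<Sum>k\<le>Suc n. of_nat (n choose k) * g k (Suc n - k))"
    using sum.atMost_Suc_shift[of "\<lambda>k. of_nat (n choose k) * g k (Suc n - k)" n]
    by simp
  also have "\<dots> = (\<Sum>k\<le>n. of_nat (n choose k) * g k (Suc (n - k)))"
    by (simp add: z Suc_diff_le)
  finally show ?thesis
    by (simp add: sum.distrib algebra_simps)
qed

lemma pochhammer_add_one:
  fixes d :: "'a::comm_ring_1"
  shows "pochhammer (d + 1) m = pochhammer d m + of_nat m * pochhammer (d + 1) (m - 1)"
proof (cases m)
  case (Suc j)
  show ?thesis
    unfolding Suc pochhammer_rec[of d] pochhammer_rec'[of "d + 1"] by (simp add: algebra_simps)
qed simp

text \<open>
  Writing $T_n(c)$ for the left-hand side and $P=(c-x)(c-y)$, the right-hand side satisfies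
  $R_{n+1}(c)=P\,R_n(c+1)$. Pascal's rule shows that $T$ fails this recurrence by
  $$T_{n+1}(c)-P\,T_n(c+1)=n(c+n)\bigl(T_n(c)-P\,T_{n-1}(c+1)\bigr),$$
  so the induction hypothesis, taken for all $c$ at once, makes the defect vanish.
\<close>

theorem pfaff_saalschuetz:
  fixes x y c :: "'a::comm_ring_1"
  shows "(\<Sum>k\<le>n. of_nat (n choose k) * (pochhammer x k * pochhammer y k *
            pochhammer (c + of_nat k) (n - k) * pochhammer (c - x - y) (n - k))) =
         pochhammer (c - x) n * pochhammer (c - y) n"
proof -
  define t where "t c k j = pochhammer x k * pochhammer y k *
      pochhammer (c + of_nat k) j * pochhammer (c - x - y) j" for c k j
  define T where "T n c = (\<Sum>k\<le>n. of_nat (n choose k) * t c k (n - k))" for n c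
  \<comment> \<open>At \<open>n = 0\<close> the truncated index \<open>n - 1\<close> is harmless because of the factor \<open>n\<close>.\<close>
  have step: "T (Suc n) c - (c - x) * (c - y) * T n (c + 1) =
      of_nat n * (c + of_nat n) * (T n c - (c - x) * (c - y) * T (n - 1) (c + 1))" for n c
  proof -
    define P where "P = (c - x) * (c - y)"
    define d where "d = c - x - y"
    define u where "u k = of_nat (n choose k) * (pochhammer x k * pochhammer y k *
        pochhammer (c + of_nat k + 1) (n - k))" for k
    have "T (Suc n) c = (\<Sum>k\<le>n. u k * (P + of_nat n * (c + of_nat k)) * pochhammer d (n - k))"
      unfolding T_def sum_binomial_Suc
    proof (intro sum.cong refl)
      fix k assume "k \<in> {..n}"
      then obtain j where j: "n = k + j"
        by (auto simp: le_iff_add)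
      have 1: "pochhammer (c + of_nat k) (Suc j) =
          (c + of_nat k) * pochhammer (c + of_nat k + 1) j"
        by (rule pochhammer_rec)
      have 2: "c + of_nat (Suc k) = c + of_nat k + 1"
        by (simp add: algebra_simps)
      show "of_nat (n choose k) * (t c k (Suc (n - k)) + t c (Suc k) (n - k)) =
          u k * (P + of_nat n * (c + of_nat k)) * pochhammer d (n - k)"
        unfolding t_def u_def 2 j diff_add_inverse 1 d_def[symmetric]
        unfolding pochhammer_Suc
        by (simp add: P_def d_def algebra_simps)
    qed
    moreover have "T n (c + 1) = (\<Sum>k\<le>n. u k * (pochhammer d (n - k) +
        of_nat (n - k) * pochhammer (d + 1) (n - k - 1)))"
      unfolding T_def
    proof (intro sum.cong refl)
      fix k
      have eqs: "c + 1 - x - y = d + 1" "c + 1 + of_nat k = c + of_nat k + 1"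
        by (simp_all add: d_def)
      show "of_nat (n choose k) * t (c + 1) k (n - k) = u k * (pochhammer d (n - k) +
          of_nat (n - k) * pochhammer (d + 1) (n - k - 1))"
        unfolding t_def u_def eqs pochhammer_add_one[symmetric] by (simp only: mult_ac)
    qed
    ultimately have "T (Suc n) c - P * T n (c + 1) =
        (\<Sum>k\<le>n. u k * of_nat n * (c + of_nat k) * pochhammer d (n - k)) -
        P * (\<Sum>k\<le>n. u k * of_nat (n - k) * pochhammer (d + 1) (n - k - 1))"
      by (simp add: sum_distrib_left sum_subtractf[symmetric] algebra_simps)
    also have "(\<Sum>k\<le>n. u k * of_nat n * (c + of_nat k) * pochhammer d (n - k)) =
        of_nat n * (c + of_nat n) * T n c"
      unfolding T_def sum_distrib_left
    proof (intro sum.cong refl)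
      fix k assume "k \<in> {..n}"
      then obtain j where j: "n = k + j"
        by (auto simp: le_iff_add)
      have nk: "n - k = j"
        by (simp add: j)
      have shift: "(c + of_nat k) * pochhammer (c + of_nat k + 1) j =
          (c + of_nat n) * pochhammer (c + of_nat k) j"
        using pochhammer_rec[of "c + of_nat k" j] pochhammer_rec'[of "c + of_nat k" j]
        by (simp add: j add_ac)
      have "u k * of_nat n * (c + of_nat k) * pochhammer d (n - k) =
          of_nat n * of_nat (n choose k) * pochhammer x k * pochhammer y k * pochhammer d j *
          ((c + of_nat k) * pochhammer (c + of_nat k + 1) j)"
        unfolding u_def nk by (simp only: mult_ac)
      also have "\<dots> = of_nat n * (c + of_nat n) * (of_nat (n choose k) * t c k (n - k))"
        unfolding shift t_def d_def[symmetric] nk by (simp only: mult_ac)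
      finally show "u k * of_nat n * (c + of_nat k) * pochhammer d (n - k) =
          of_nat n * (c + of_nat n) * (of_nat (n choose k) * t c k (n - k))" .
    qed
    also have "(\<Sum>k\<le>n. u k * of_nat (n - k) * pochhammer (d + 1) (n - k - 1)) =
        of_nat n * (c + of_nat n) * T (n - 1) (c + 1)"
    proof (cases n)
      case (Suc m)
      have "(\<Sum>k\<le>n. u k * of_nat (n - k) * pochhammer (d + 1) (n - k - 1)) =
          (\<Sum>k\<le>m. u k * of_nat (n - k) * pochhammer (d + 1) (n - k - 1))"
        by (simp add: Suc)
      also have "\<dots> = of_nat n * (c + of_nat n) * T m (c + 1)"
        unfolding T_def sum_distrib_left
      proof (intro sum.cong refl)
        fix k assume "k \<in> {..m}"
        then obtain j where j: "m = k + j"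
          by (auto simp: le_iff_add)
        have "(n choose k) * (n - k) = n * (m choose k)"
          using binomial_absorb_comp[of n k] Suc by (simp add: mult.commute)
        then have 1: "of_nat (n choose k) * of_nat (n - k) = of_nat n * (of_nat (m choose k) :: 'a)"
          by (metis of_nat_mult)
        have 2: "pochhammer (c + of_nat k + 1) (n - k) =
            (c + of_nat n) * pochhammer (c + 1 + of_nat k) (m - k)"
          by (simp add: Suc j pochhammer_rec' add_ac)
        have 3: "c + 1 - x - y = d + 1" "n - k - 1 = m - k"
          by (simp_all add: d_def Suc)
        have "u k * of_nat (n - k) * pochhammer (d + 1) (n - k - 1) =
            (of_nat (n choose k) * of_nat (n - k)) * (c + of_nat n) * pochhammer x k *
            pochhammer y k * pochhammer (c + 1 + of_nat k) (m - k) * pochhammer (d + 1) (m - k)"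
          unfolding u_def 2 3 by (simp only: mult_ac)
        also have "\<dots> = of_nat n * (c + of_nat n) * (of_nat (m choose k) * t (c + 1) k (m - k))"
          unfolding 1 t_def 3 by (simp only: mult_ac)
        finally show "u k * of_nat (n - k) * pochhammer (d + 1) (n - k - 1) =
            of_nat n * (c + of_nat n) * (of_nat (m choose k) * t (c + 1) k (m - k))" .
      qed
      finally show ?thesis
        by (simp add: Suc)
    qed simp
    finally show ?thesis
      by (simp add: P_def algebra_simps)
  qed
  have "T n c = pochhammer (c - x) n * pochhammer (c - y) n" for c
  proof (induction n arbitrary: c rule: less_induct)
    case (less n)
    show ?case
    proof (cases n)
      case 0
      then show ?thesis
        by (simp add: T_def t_def)
    next
      case (Suc m)
      have nxt: "(c - x) * (c - y) * T j (c + 1) = pochhammer (c - x) (Suc j) * pochhammer (c - y) (Suc j)"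
        if "j < n" for j
        using less.IH[OF that, of "c + 1"]
        by (simp add: pochhammer_rec algebra_simps)
      have "of_nat m * (c + of_nat m) * (T m c - (c - x) * (c - y) * T (m - 1) (c + 1)) = 0"
      proof (cases m)
        case (Suc j)
        then show ?thesis
          using nxt[of j] less.IH[of m c] \<open>n = Suc m\<close> by simp
      qed simp
      then show ?thesis
        using step[of m c] nxt[of m] Suc by simp
    qed
  qed
  then show ?thesis
    by (simp add: T_def t_def)
qed

section \<open>Coefficient identities\<close>

text \<open>
  In terms of $1/\Gamma$ the duplication formula has no exceptions: both sides vanish at the poles.
\<close>

lemma rGamma_legendre_duplication:
  fixes z :: complex
  shows "rGamma (2 * z) = of_real (sqrt pi) * 2 powr (1 - 2 * z) * (rGamma z * rGamma (z + 1/2))"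
proof (cases "z \<in> \<int>\<^sub>\<le>\<^sub>0 \<or> z + 1/2 \<in> \<int>\<^sub>\<le>\<^sub>0")
  case True
  then have "2 * z \<in> \<int>\<^sub>\<le>\<^sub>0"
  proof
    assume "z \<in> \<int>\<^sub>\<le>\<^sub>0"
    then obtain n where "z = - of_nat n"
      by (elim nonpos_Ints_cases')
    then have "2 * z = - of_nat (2 * n)"
      by simp
    then show ?thesis
      by (metis minus_of_nat_in_nonpos_Ints)
  next
    assume "z + 1/2 \<in> \<int>\<^sub>\<le>\<^sub>0"
    then obtain n where "z + 1/2 = - of_nat n"
      by (elim nonpos_Ints_cases')
    then have "2 * (z + 1/2) - 1 = - of_nat (2 * n + 1)"
      by simp
    then have "2 * z = - of_nat (2 * n + 1)"
      by (simp add: distrib_left)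
    then show ?thesis
      by (metis minus_of_nat_in_nonpos_Ints)
  qed
  then have "rGamma (2 * z) = 0"
    by (simp only: rGamma_eq_zero_iff)
  moreover have "rGamma z * rGamma (z + 1/2) = 0"
    using True by (metis mult_eq_0_iff rGamma_eq_zero_iff)
  ultimately show ?thesis
    by (simp only: mult_zero_right)
next
  case False
  then have "Gamma z * Gamma (z + 1/2) =
      exp ((1 - 2 * z) * of_real (ln 2)) * of_real (sqrt pi) * Gamma (2 * z)"
    by (intro Gamma_legendre_duplication) auto
  moreover have "exp ((1 - 2 * z) * of_real (ln 2)) = 2 powr (1 - 2 * z)"
    by (simp add: powr_def flip: Ln_of_real)
  moreover have "Gamma z \<noteq> 0" "Gamma (z + 1/2) \<noteq> 0"
    using False by (auto simp: Gamma_eq_zero_iff)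
  ultimately show ?thesis
    by (simp add: rGamma_inverse_Gamma field_simps)
qed

text \<open>
  This brings the normalizing factors of all terms of a finite sum to the common factor
  $1/\Gamma(c+n)$, which turns the coefficient identities below into polynomial ones.
\<close>

lemma pochhammer_mult_rGamma:
  fixes c :: "'a::Gamma"
  assumes "k \<le> n"
  shows "rGamma (c + of_nat k) = pochhammer (c + of_nat k) (n - k) * rGamma (c + of_nat n)"
  using pochhammer_rGamma[of "c + of_nat k" "n - k"] assms by (simp add: add.assoc flip: of_nat_add)

lemma divide_facts:
  fixes u v :: "'a::field_char_0"
  assumes "k \<le> n"
  shows "u / fact k * (v / fact (n - k)) = of_nat (n choose k) * (u * v) / fact n"
  using assms by (simp add: binomial_fact)

text \<open>
  The coefficients of Euler's transformation: the Pfaff--Saalschuetz sum with $x=c-a$ and $y=c-b$.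
\<close>

lemma euler_coeff:
  fixes a b c :: complex
  shows "(\<Sum>k\<le>n. pochhammer (c - a) k * pochhammer (c - b) k * rGamma (c + of_nat k) / fact k *
            (pochhammer (a + b - c) (n - k) / fact (n - k))) =
         pochhammer a n * pochhammer b n * rGamma (c + of_nat n) / fact n" (is "?L = ?R")
proof -
  have eq: "c - (c - a) - (c - b) = a + b - c"
    by simp
  have "?L = (\<Sum>k\<le>n. of_nat (n choose k) * (pochhammer (c - a) k * pochhammer (c - b) k *
       pochhammer (c + of_nat k) (n - k) * pochhammer (c - (c - a) - (c - b)) (n - k))) *
       (rGamma (c + of_nat n) / fact n)"
    unfolding sum_distrib_right
  proof (intro sum.cong refl)
    fix k assume "k \<in> {..n}"
    then have le: "k \<le> n" by simp
    show "pochhammer (c - a) k * pochhammer (c - b) k * rGamma (c + of_nat k) / fact k *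
        (pochhammer (a + b - c) (n - k) / fact (n - k)) =
        of_nat (n choose k) * (pochhammer (c - a) k * pochhammer (c - b) k *
        pochhammer (c + of_nat k) (n - k) * pochhammer (c - (c - a) - (c - b)) (n - k)) *
        (rGamma (c + of_nat n) / fact n)"
      unfolding divide_facts[OF le] pochhammer_mult_rGamma[OF le] eq
      by (simp only: mult_ac times_divide_eq_right times_divide_eq_left)
  qed
  also have "\<dots> = ?R"
    unfolding pfaff_saalschuetz by simp
  finally show ?thesis .
qed

text \<open>
  After multiplication by $(A+\frac12)_n$, the duplication formula for Pochhammer symbols produces
  $(2A)_{n+k}=(2A)_n(2A+n)_k$ in every term, and $(2A)_n$ comes out of the sum. What remains is,
  up to the sign $(-1)^n$, the Pfaff--Saalschuetz sum with
  $c=A+B+\frac12$, $x=2A+n$ and $y=B$.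
\<close>

lemma quadratic_poly_generic:
  fixes A B :: complex
  shows "(\<Sum>k\<le>n. of_nat (n choose k) * ((-4) ^ k * pochhammer A k * pochhammer (2 * A + 2 * of_nat k) (n - k) *
             pochhammer B k * pochhammer (A + B + 1/2 + of_nat k) (n - k))) * pochhammer (A + 1/2) n =
         pochhammer (2 * A) n * pochhammer (A - B + 1/2) n * pochhammer (A + 1/2) n"
proof -
  define c where "c = A + B + 1/2"
  have cxy: "c - (2 * A + of_nat n) - B = - (A + of_nat n - 1/2)"
    "c - (2 * A + of_nat n) = - (A - B + of_nat n - 1/2)" "c - B = A + 1/2"
    by (simp_all add: c_def field_simps)
  have coeff: "(-4) ^ k * pochhammer A k * pochhammer (2 * A + 2 * of_nat k) (n - k) * pochhammer (A + 1/2) n =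
      (-1) ^ n * pochhammer (2 * A) n * pochhammer (2 * A + of_nat n) k *
      pochhammer (- (A + of_nat n - 1/2)) (n - k)" if le: "k \<le> n" for k
  proof -
    obtain j where j: "n = k + j"
      using le_Suc_ex[OF le] by blast
    have nk2: "n + k = 2 * k + j"
      by (simp add: j)
    have "pochhammer (2 * A) n * pochhammer (2 * A + of_nat n) k = pochhammer (2 * A) (2 * k + j)"
      by (simp only: flip: nk2 pochhammer_product')
    also have "\<dots> = 4 ^ k * pochhammer A k * pochhammer (A + 1/2) k * pochhammer (2 * A + 2 * of_nat k) j"
      unfolding pochhammer_product' pochhammer_double by (simp add: power_mult)
    finally have 1: "pochhammer (2 * A) n * pochhammer (2 * A + of_nat n) k = \<dots>" .
    have 2: "pochhammer (A + 1/2) n = pochhammer (A + 1/2) k * pochhammer (A + 1/2 + of_nat k) j"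
      unfolding j by (rule pochhammer_product')
    have shift: "A + of_nat n - 1/2 - of_nat j + 1 = A + 1/2 + of_nat k"
      by (simp add: j)
    have 3: "pochhammer (- (A + of_nat n - 1/2)) j = (-1) ^ j * pochhammer (A + 1/2 + of_nat k) j"
      unfolding pochhammer_minus shift ..
    have 4: "(-1) ^ n * (-1) ^ j = (-1 :: complex) ^ k"
      by (simp add: j power_add flip: power_mult_distrib)
    have 5: "(-4) ^ k = (-1) ^ k * (4 :: complex) ^ k"
      by (simp flip: power_mult_distrib)
    have nk: "n - k = j"
      by (simp add: j)
    have "(-1) ^ n * pochhammer (2 * A) n * pochhammer (2 * A + of_nat n) k *
        pochhammer (- (A + of_nat n - 1/2)) (n - k) =
        ((-1) ^ n * (-1) ^ j) * (pochhammer (2 * A) n * pochhammer (2 * A + of_nat n) k) *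
        pochhammer (A + 1/2 + of_nat k) j"
      unfolding nk 3 by (simp only: mult_ac)
    also have "\<dots> = (-4) ^ k * pochhammer A k * pochhammer (2 * A + 2 * of_nat k) (n - k) *
        pochhammer (A + 1/2) n"
      unfolding 1 2 4 5 nk by (simp only: mult_ac)
    finally show ?thesis ..
  qed
  have "(\<Sum>k\<le>n. of_nat (n choose k) * ((-4) ^ k * pochhammer A k * pochhammer (2 * A + 2 * of_nat k) (n - k) *
             pochhammer B k * pochhammer (c + of_nat k) (n - k))) * pochhammer (A + 1/2) n =
        (-1) ^ n * pochhammer (2 * A) n * (\<Sum>k\<le>n. of_nat (n choose k) *
           (pochhammer (2 * A + of_nat n) k * pochhammer B k * pochhammer (c + of_nat k) (n - k) *
            pochhammer (c - (2 * A + of_nat n) - B) (n - k)))"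
    unfolding sum_distrib_left sum_distrib_right cxy(1)
  proof (intro sum.cong refl)
    fix k assume "k \<in> {..n}"
    then have "k \<le> n" by simp
    show "of_nat (n choose k) * ((-4) ^ k * pochhammer A k * pochhammer (2 * A + 2 * of_nat k) (n - k) *
             pochhammer B k * pochhammer (c + of_nat k) (n - k)) * pochhammer (A + 1/2) n =
        (-1) ^ n * pochhammer (2 * A) n * (of_nat (n choose k) *
           (pochhammer (2 * A + of_nat n) k * pochhammer B k * pochhammer (c + of_nat k) (n - k) *
            pochhammer (- (A + of_nat n - 1/2)) (n - k)))"
      using arg_cong[OF coeff[OF \<open>k \<le> n\<close>],
        of "\<lambda>u. of_nat (n choose k) * (pochhammer B k * pochhammer (c + of_nat k) (n - k)) * u"]
      by (simp only: mult_ac)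
  qed
  also have "\<dots> = pochhammer (2 * A) n * ((-1) ^ n * pochhammer (- (A - B + of_nat n - 1/2)) n) *
      pochhammer (A + 1/2) n"
    unfolding pfaff_saalschuetz unfolding cxy(2,3) by (simp only: mult_ac)
  also have "(-1) ^ n * pochhammer (- (A - B + of_nat n - 1/2)) n = pochhammer (A - B + 1/2) n"
    using pochhammer_minus'[of "A - B + of_nat n - 1/2" n] by (simp add: algebra_simps)
  finally show ?thesis
    by (simp only: c_def)
qed

text \<open>
  The factor $(A+\frac12)_n$ may vanish, so it is cancelled by continuity in $A$: it has finitely
  many zeros.
\<close>

lemma quadratic_poly:
  fixes A B :: complex
  shows "(\<Sum>k\<le>n. of_nat (n choose k) * ((-4) ^ k * pochhammer A k * pochhammer (2 * A + 2 * of_nat k) (n - k) *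
             pochhammer B k * pochhammer (A + B + 1/2 + of_nat k) (n - k))) =
         pochhammer (2 * A) n * pochhammer (A - B + 1/2) n" (is "?f A = ?g A")
proof -
  let ?S = "(\<lambda>i. - 1/2 - of_nat i) ` {..<n} :: complex set"
  have generic: "?f a = ?g a" if "a \<in> - ?S" for a
  proof -
    have nz: "pochhammer (a + 1/2) n \<noteq> 0"
    proof
      assume "pochhammer (a + 1/2) n = 0"
      then obtain i where "i < n" "a + 1/2 = - of_nat i"
        by (auto simp: pochhammer_eq_0_iff)
      then have "a = - 1/2 - of_nat i"
        by algebra
      then have "a \<in> ?S"
        using \<open>i < n\<close> by blast
      with that show False by simp
    qed
    show ?thesis
      using quadratic_poly_generic[of n a B] by (simp only: mult_right_cancel[OF nz])
  qed
  have "?f A - ?g A = 0"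
  proof (rule continuous_constant_on_closure[of "- ?S" "\<lambda>a. ?f a - ?g a" 0 A])
    show "continuous_on (closure (- ?S)) (\<lambda>a. ?f a - ?g a)"
      unfolding pochhammer_prod by (intro continuous_intros)
    show "A \<in> closure (- ?S)"
      by (simp add: closure_complement empty_interior_finite)
    show "?f x - ?g x = 0" if "x \<in> - ?S" for x
      using generic[OF that] by (simp only: right_minus_eq)
  qed
  then show ?thesis
    by (simp only: right_minus_eq)
qed

text \<open>
  The coefficients of
  ${}_2\mathbf F_1(A,B;c;-4s/(1-s)^2)\,(1-s)^{-2A}={}_2\mathbf F_1(2A,A-B+\frac12;c;s)$.
\<close>

lemma quadratic_coeff:
  fixes A B :: complex
  defines "c \<equiv> A + B + 1/2"
  shows "(\<Sum>k\<le>n. pochhammer A k * pochhammer B k * rGamma (c + of_nat k) / fact k * (-4) ^ k *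
            (pochhammer (2 * A + 2 * of_nat k) (n - k) / fact (n - k))) =
         pochhammer (2 * A) n * pochhammer (A - B + 1/2) n * rGamma (c + of_nat n) / fact n" (is "?L = ?R")
proof -
  have "?L = (\<Sum>k\<le>n. of_nat (n choose k) * ((-4) ^ k * pochhammer A k * pochhammer (2 * A + 2 * of_nat k) (n - k) *
             pochhammer B k * pochhammer (A + B + 1/2 + of_nat k) (n - k))) * (rGamma (c + of_nat n) / fact n)"
    unfolding sum_distrib_right
  proof (intro sum.cong refl)
    fix k assume "k \<in> {..n}"
    then have le: "k \<le> n" by simp
    have "pochhammer A k * pochhammer B k * rGamma (c + of_nat k) / fact k * (-4) ^ k *
            (pochhammer (2 * A + 2 * of_nat k) (n - k) / fact (n - k)) =
          pochhammer A k * pochhammer B k * rGamma (c + of_nat k) * (-4) ^ k / fact k *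
            (pochhammer (2 * A + 2 * of_nat k) (n - k) / fact (n - k))"
      by (simp only: mult_ac times_divide_eq_right times_divide_eq_left)
    also have "\<dots> = of_nat (n choose k) * ((-4) ^ k * pochhammer A k *
        pochhammer (2 * A + 2 * of_nat k) (n - k) *
        pochhammer B k * pochhammer (A + B + 1/2 + of_nat k) (n - k)) * (rGamma (c + of_nat n) / fact n)"
      unfolding divide_facts[OF le] pochhammer_mult_rGamma[OF le] c_def
      by (simp only: mult_ac times_divide_eq_right times_divide_eq_left)
    finally show "pochhammer A k * pochhammer B k * rGamma (c + of_nat k) / fact k * (-4) ^ k *
        (pochhammer (2 * A + 2 * of_nat k) (n - k) / fact (n - k)) = \<dots>" .
  qed
  also have "\<dots> = ?R"
    unfolding quadratic_poly by (simp only: times_divide_eq_right)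
  finally show ?thesis .
qed

lemma pochhammer_double_add:
  fixes p :: "'a::field_char_0"
  assumes "e \<le> 1"
  shows "pochhammer (2 * p) (2 * N + e) = 2 ^ (2 * N + e) * pochhammer p (N + e) * pochhammer (p + 1/2) N"
proof -
  consider "e = 0" | "e = 1" using assms by linarith
  then show ?thesis
  proof cases
    case 1
    then show ?thesis by (simp add: pochhammer_double)
  next
    case 2
    have "pochhammer (2 * p) (2 * N + 1) = pochhammer (2 * p) (2 * N) * (2 * (p + of_nat N))"
      by (simp add: pochhammer_Suc algebra_simps)
    also have "\<dots> = 2 ^ (2 * N + 1) * (pochhammer p N * (p + of_nat N)) * pochhammer (p + 1/2) N"
      unfolding pochhammer_double by simp
    finally show ?thesis
      unfolding 2 by (simp only: Suc_eq_plus1[symmetric] pochhammer_Suc)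
  qed
qed

lemma fact_double_add:
  assumes "e \<le> 1"
  shows "(fact (2 * N + e) :: 'a::field_char_0) = 4 ^ N * fact N * pochhammer (of_nat e + 1/2) N"
proof -
  consider "e = 0" | "e = 1" using assms by linarith
  then show ?thesis
  proof cases
    case 1
    then show ?thesis by (simp add: fact_double power_mult)
  next
    case 2
    have four: "(2 :: 'a) ^ (2 * N) = 4 ^ N"
      by (simp add: power_mult)
    have "fact (2 * N + 1) = (2 * of_nat N + 1) * (fact (2 * N) :: 'a)"
      by (simp add: algebra_simps)
    also have "\<dots> = 4 ^ N * fact N * (2 * (pochhammer (1/2) N * (1/2 + of_nat N)))"
      unfolding fact_double four by (simp add: algebra_simps)
    also have "2 * (pochhammer (1/2) N * (1/2 + of_nat N)) = pochhammer (1/2 + 1 :: 'a) N"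
      using pochhammer_rec[of "1/2 :: 'a" N] pochhammer_rec'[of "1/2 :: 'a" N] by (simp add: mult_ac)
    finally show ?thesis
      unfolding 2 by (simp add: add_ac)
  qed
qed

text \<open>
  The coefficients of the transformation from $F(2p,b;2b;\zeta)$ to
  $F(p,b-p;b+\frac12;-\zeta^2/(4(1-\zeta)))$. Since $\zeta^2$ occurs on the right, the coefficient
  of $\zeta^n$ is a sum up to $N=\lfloor n/2\rfloor$ and both parities $e$ of $n=2N+e$ have to be
  covered. In either case it is the Pfaff--Saalschuetz sum with $x=b-p$, $c=b+\frac12$ and
  $y=\frac12-e-N$: the symbol $(y)_k$ arises from the quotient of factorials $n!/(n-2k)!$.
\<close>

lemma quadratic_coeff_double:
  fixes p b :: complex
  assumes e: "e \<le> 1"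
  shows "(\<Sum>k\<le>N. pochhammer p k * pochhammer (b - p) k * rGamma (b + 1/2 + of_nat k) / fact k * (-1/4) ^ k *
            (pochhammer (p + of_nat k) (2 * (N - k) + e) / fact (2 * (N - k) + e))) *
           (of_real (sqrt pi) * 2 powr (1 - 2 * b) * rGamma b) =
         pochhammer (2 * p) (2 * N + e) * pochhammer b (2 * N + e) * rGamma (2 * b + of_nat (2 * N + e)) /
           fact (2 * N + e)"
proof -
  define c h y where "c = b + 1/2" and "h = of_nat e + (1/2 :: complex)" and "y = 1 - h - of_nat N"
  have cxy: "c - (b - p) - y = p + of_nat (N + e)" "c - (b - p) = p + 1/2" "c - y = b + of_nat (N + e)"
    by (simp_all add: c_def h_def y_def field_simps)
  have h_nz: "pochhammer h j \<noteq> 0" for j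
    using fact_double_add[OF e, of j, where ?'a = complex] by (auto simp: h_def)
  define M where "M = pochhammer p (N + e) / fact (2 * N + e)"
  have coeff: "pochhammer p k * pochhammer (b - p) k * rGamma (c + of_nat k) / fact k * (-1/4) ^ k *
            (pochhammer (p + of_nat k) (2 * (N - k) + e) / fact (2 * (N - k) + e)) =
         (of_nat (N choose k) * (pochhammer (b - p) k * pochhammer y k * pochhammer (c + of_nat k) (N - k) *
          pochhammer (c - (b - p) - y) (N - k))) * (M * rGamma (c + of_nat N))" if le: "k \<le> N" for k
  proof -
    obtain j where j: "N = k + j"
      using le_Suc_ex[OF le] by blast
    have Nk: "N - k = j"
      by (simp add: j)
    have y: "y = - (h + of_nat N - 1)" "h + of_nat N - 1 - of_nat k + 1 = h + of_nat j"
      by (simp_all add: y_def j)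
    have "pochhammer y k * pochhammer h j = (-1) ^ k * (pochhammer h j * pochhammer (h + of_nat j) k)"
      unfolding y(1) pochhammer_minus y(2) by (simp only: mult_ac)
    also have "pochhammer h j * pochhammer (h + of_nat j) k = pochhammer h N"
      unfolding j by (subst add.commute) (simp only: pochhammer_product')
    finally have py: "pochhammer y k = (-1) ^ k * pochhammer h N / pochhammer h j"
      using h_nz[of j] by (simp add: field_simps)
    have "pochhammer p k * pochhammer (p + of_nat k) (2 * j + e) = pochhammer p (k + (2 * j + e))"
      by (simp only: pochhammer_product')
    also have "k + (2 * j + e) = N + e + j"
      by (simp add: j)
    also have "pochhammer p (N + e + j) = pochhammer p (N + e) * pochhammer (p + of_nat (N + e)) j"
      by (simp only: pochhammer_product')
    finally have pp: "pochhammer p k * pochhammer (p + of_nat k) (2 * j + e) = \<dots>" .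
    have f1: "fact (2 * j + e) = 4 ^ j * fact j * pochhammer h j"
      and f2: "fact (2 * N + e) = 4 ^ N * fact N * pochhammer h N"
      unfolding h_def by (rule fact_double_add[OF e])+
    have ch: "of_nat (N choose k) = (fact N / (fact k * fact j) :: complex)"
      using binomial_fact[OF le, where ?'a = complex] by (simp only: Nk)
    have p4: "(-1/4 :: complex) ^ k = (-1) ^ k * 4 ^ j / 4 ^ N"
      unfolding j power_add using power_divide[of "-1 :: complex" 4 k] by simp
    have "pochhammer p k * pochhammer (b - p) k * rGamma (c + of_nat k) / fact k * (-1/4) ^ k *
            (pochhammer (p + of_nat k) (2 * (N - k) + e) / fact (2 * (N - k) + e)) =
        (pochhammer p k * pochhammer (p + of_nat k) (2 * j + e)) * pochhammer (b - p) k *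
        (pochhammer (c + of_nat k) j * rGamma (c + of_nat N)) *
        ((-1/4) ^ k / (fact k * fact (2 * j + e)))"
      unfolding pochhammer_mult_rGamma[OF le] unfolding Nk
      by (simp only: mult_ac times_divide_eq_right times_divide_eq_left divide_divide_eq_left)
    also have "(-1/4) ^ k / (fact k * fact (2 * j + e)) =
        of_nat (N choose k) * pochhammer y k / (fact (2 * N + e) :: complex)"
      unfolding f1 f2 ch p4 py using h_nz[of j] h_nz[of N] by (simp add: field_simps)
    finally show ?thesis
      unfolding pp M_def Nk cxy(1)
      by (simp only: mult_ac times_divide_eq_right times_divide_eq_left)
  qed
  have "(\<Sum>k\<le>N. pochhammer p k * pochhammer (b - p) k * rGamma (c + of_nat k) / fact k * (-1/4) ^ k *
            (pochhammer (p + of_nat k) (2 * (N - k) + e) / fact (2 * (N - k) + e))) =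
        (\<Sum>k\<le>N. of_nat (N choose k) * (pochhammer (b - p) k * pochhammer y k * pochhammer (c + of_nat k) (N - k) *
          pochhammer (c - (b - p) - y) (N - k))) * (M * rGamma (c + of_nat N))"
    unfolding sum_distrib_right by (intro sum.cong refl coeff) simp
  also have "\<dots> = pochhammer (p + 1/2) N * pochhammer (b + of_nat (N + e)) N * (M * rGamma (c + of_nat N))"
    unfolding pfaff_saalschuetz unfolding cxy(2,3) ..
  finally have sum_eq: "(\<Sum>k\<le>N. pochhammer p k * pochhammer (b - p) k * rGamma (c + of_nat k) / fact k * (-1/4) ^ k *
            (pochhammer (p + of_nat k) (2 * (N - k) + e) / fact (2 * (N - k) + e))) = \<dots>" .
  \<comment> \<open>The duplication formula at \<open>b + n / 2\<close>; the two reciprocal Gamma factors swap roles with the parity.\<close>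
  have dup: "pochhammer b (2 * N + e) * rGamma (2 * b + of_nat (2 * N + e)) * 2 ^ (2 * N + e) =
      pochhammer (b + of_nat (N + e)) N * rGamma (c + of_nat N) *
      (of_real (sqrt pi) * 2 powr (1 - 2 * b) * rGamma b)"
  proof -
    define z where "z = b + of_nat N + of_nat e / 2"
    have z2: "2 * b + of_nat (2 * N + e) = 2 * z" "1 - 2 * z = (1 - 2 * b) - of_nat (2 * N + e)"
      by (simp_all add: z_def algebra_simps)
    have zz: "rGamma z * rGamma (z + 1/2) = rGamma (b + of_nat (N + e)) * rGamma (c + of_nat N)"
    proof -
      consider "e = 0" | "e = 1" using e by linarith
      then show ?thesis
      proof cases
        case 1
        then have "z = b + of_nat (N + e)" "z + 1/2 = c + of_nat N"
          by (simp_all add: z_def c_def)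
        then show ?thesis by (simp only:)
      next
        case 2
        then have "z + 1/2 = b + of_nat (N + e)" "z = c + of_nat N"
          by (simp_all add: z_def c_def)
        then show ?thesis by (simp only: mult.commute)
      qed
    qed
    have "2 * N + e = (N + e) + N"
      by simp
    then have f1: "pochhammer b (2 * N + e) = pochhammer b (N + e) * pochhammer (b + of_nat (N + e)) N"
      by (simp only: pochhammer_product')
    have f2: "2 powr (1 - 2 * z) * 2 ^ (2 * N + e) = (2 :: complex) powr (1 - 2 * b)"
    proof -
      have "2 powr (1 - 2 * z) * 2 ^ (2 * N + e) = 2 powr (1 - 2 * z) * (2 :: complex) powr of_nat (2 * N + e)"
        by (subst powr_nat') simp_all
      also have "\<dots> = 2 powr (1 - 2 * z + of_nat (2 * N + e))"
        by (simp only: powr_add)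
      finally show ?thesis
        by (simp add: z2(2))
    qed
    have f3: "rGamma (2 * z) = of_real (sqrt pi) * 2 powr (1 - 2 * z) * (rGamma z * rGamma (z + 1/2))"
      by (rule rGamma_legendre_duplication)
    have f4: "rGamma b = pochhammer b (N + e) * rGamma (b + of_nat (N + e))"
      by (rule pochhammer_rGamma)
    show ?thesis
      unfolding z2(1) f1 f3 zz f2[symmetric] by (subst f4) (simp only: mult_ac)
  qed
  have "pochhammer (2 * p) (2 * N + e) * pochhammer b (2 * N + e) * rGamma (2 * b + of_nat (2 * N + e)) /
        fact (2 * N + e) =
      M * pochhammer (p + 1/2) N *
        (pochhammer b (2 * N + e) * rGamma (2 * b + of_nat (2 * N + e)) * 2 ^ (2 * N + e))"
    unfolding pochhammer_double_add[OF e] M_def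
    by (simp only: mult_ac times_divide_eq_right times_divide_eq_left)
  then show ?thesis
    unfolding dup c_def[symmetric] sum_eq by (simp only: mult_ac)
qed

section \<open>Gauss series as formal power series\<close>

definition gauss_fps :: "complex \<Rightarrow> complex \<Rightarrow> complex \<Rightarrow> complex fps" where
  "gauss_fps a b c = Abs_fps (\<lambda>k. pochhammer a k * pochhammer b k * rGamma (c + of_nat k) / fact k)"

text \<open>
  The series of $(1-z)^{-a}$.
\<close>

definition neg_binomial_fps :: "'a::field_char_0 \<Rightarrow> 'a fps" where
  "neg_binomial_fps a = Abs_fps (\<lambda>n. pochhammer a n / fact n)"

lemma neg_binomial_fps_add:
  "neg_binomial_fps a * neg_binomial_fps b = neg_binomial_fps (a + b)"
proof (rule fps_ext)
  fix n
  have "fps_nth (neg_binomial_fps a * neg_binomial_fps b) n =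
      (\<Sum>k\<le>n. pochhammer a k / fact k * (pochhammer b (n - k) / fact (n - k)))"
    by (simp only: fps_mult_nth neg_binomial_fps_def fps_nth_Abs_fps atLeast0AtMost)
  also have "\<dots> = (\<Sum>k\<le>n. of_nat (n choose k) * pochhammer a k * pochhammer b (n - k)) / fact n"
    unfolding sum_divide_distrib
    by (intro sum.cong refl) (simp only: divide_facts atMost_iff mult.assoc)
  finally show "fps_nth (neg_binomial_fps a * neg_binomial_fps b) n = fps_nth (neg_binomial_fps (a + b)) n"
    by (simp only: pochhammer_binomial_sum neg_binomial_fps_def fps_nth_Abs_fps)
qed

lemma neg_binomial_fps_0: "neg_binomial_fps 0 = 1"
  by (rule fps_ext) (simp add: neg_binomial_fps_def pochhammer_0_left)

lemma neg_binomial_fps_power: "neg_binomial_fps a ^ k = neg_binomial_fps (of_nat k * a)"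
  by (induction k) (simp_all add: neg_binomial_fps_0 neg_binomial_fps_add algebra_simps)

lemma has_fps_expansion_neg_binomial:
  fixes a :: complex
  shows "(\<lambda>z. (1 - z) powr (-a)) has_fps_expansion neg_binomial_fps a"
proof (rule has_fps_expansionI)
  have "eventually (\<lambda>z::complex. z \<in> ball 0 1) (nhds 0)"
    by (rule eventually_nhds_in_open) auto
  then show "\<forall>\<^sub>F z in nhds 0. (\<lambda>n. fps_nth (neg_binomial_fps a) n * z ^ n) sums (1 - z) powr (-a)"
  proof eventually_elim
    case (elim z)
    then have "(\<lambda>n. ((-a) gchoose n) * (-z) ^ n) sums (1 + (-z)) powr (-a)"
      by (intro gen_binomial_complex) auto
    moreover have "((-a) gchoose n) * (-z) ^ n = fps_nth (neg_binomial_fps a) n * z ^ n" for n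
      by (simp add: neg_binomial_fps_def gbinomial_pochhammer power_minus[of z] flip: power_add)
    ultimately show ?case
      by simp
  qed
qed

text \<open>
  Both quadratic transformations substitute $h=q\,s^m(1-s)^{-r}$ into a series $f$ and multiply by
  $(1-s)^{-a}$. Each power of $h$ again has this shape, so the coefficients of the result are finite
  sums of coefficients of $f$ and binomial coefficients.
\<close>

lemma fps_nth_compose_mult_neg_binomial:
  fixes f :: "'a::field_char_0 fps"
  assumes m: "m > 0"
  shows "fps_nth ((f oo (fps_const q * fps_X ^ m * neg_binomial_fps r)) * neg_binomial_fps a) n =
         (\<Sum>k\<le>n. fps_nth f k * q ^ k *
            (if m * k \<le> n then fps_nth (neg_binomial_fps (a + of_nat k * r)) (n - m * k) else 0))"
proof -
  define h where "h = fps_const q * fps_X ^ m * neg_binomial_fps r"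
  have hk: "h ^ k * g = fps_const (q ^ k) * (fps_X ^ (m * k) * (neg_binomial_fps (of_nat k * r) * g))" for k g
    by (simp add: h_def power_mult_distrib neg_binomial_fps_power fps_const_power mult.assoc flip: power_mult)
  have hk_nth: "fps_nth (h ^ k * g) j = q ^ k *
      (if m * k \<le> j then fps_nth (neg_binomial_fps (of_nat k * r) * g) (j - m * k) else 0)" for k g j
    unfolding hk by (simp add: fps_X_power_mult_nth)
  have h0: "fps_nth (h ^ k) j = 0" if "j < k" for k j
  proof -
    have "k \<le> m * k" using m by simp
    with that have "\<not> m * k \<le> j" by linarith
    then show ?thesis
      using hk_nth[of k 1 j] by simp
  qed
  have "fps_nth ((f oo h) * neg_binomial_fps a) n =
      (\<Sum>j\<le>n. (\<Sum>k\<le>n. fps_nth f k * fps_nth (h ^ k) j) * fps_nth (neg_binomial_fps a) (n - j))"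
    unfolding fps_mult_nth atLeast0AtMost fps_compose_nth
  proof (intro sum.cong refl)
    fix j assume "j \<in> {..n}"
    then have "(\<Sum>k\<le>j. fps_nth f k * fps_nth (h ^ k) j) = (\<Sum>k\<le>n. fps_nth f k * fps_nth (h ^ k) j)"
      by (intro sum.mono_neutral_left) (auto simp: h0)
    then show "(\<Sum>k\<le>j. fps_nth f k * fps_nth (h ^ k) j) * fps_nth (neg_binomial_fps a) (n - j) =
        (\<Sum>k\<le>n. fps_nth f k * fps_nth (h ^ k) j) * fps_nth (neg_binomial_fps a) (n - j)"
      by simp
  qed
  also have "\<dots> = (\<Sum>k\<le>n. fps_nth f k * fps_nth (h ^ k * neg_binomial_fps a) n)"
    unfolding sum_distrib_right fps_mult_nth atLeast0AtMost sum_distrib_left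
    by (subst sum.swap) (simp add: mult.assoc)
  also have "\<dots> = (\<Sum>k\<le>n. fps_nth f k * q ^ k *
            (if m * k \<le> n then fps_nth (neg_binomial_fps (a + of_nat k * r)) (n - m * k) else 0))"
    unfolding hk_nth neg_binomial_fps_add by (simp only: add.commute mult.assoc)
  finally show ?thesis
    by (simp only: h_def)
qed

lemma gauss_fps_euler:
  "gauss_fps (c - a) (c - b) c * neg_binomial_fps (a + b - c) = gauss_fps a b c"
  by (rule fps_ext)
     (simp only: fps_mult_nth atLeast0AtMost gauss_fps_def neg_binomial_fps_def fps_nth_Abs_fps euler_coeff)

lemma gauss_fps_quadratic:
  "(gauss_fps A B (A + B + 1/2) oo (fps_const (-4) * fps_X ^ 1 * neg_binomial_fps 2)) *
     neg_binomial_fps (2 * A) =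
   gauss_fps (2 * A) (A - B + 1/2) (A + B + 1/2)" (is "?L = ?R")
proof (rule fps_ext)
  fix n
  show "fps_nth ?L n = fps_nth ?R n"
    unfolding fps_nth_compose_mult_neg_binomial[OF zero_less_one]
    unfolding gauss_fps_def fps_nth_Abs_fps
      quadratic_coeff[symmetric] neg_binomial_fps_def
    by (intro sum.cong refl) (simp add: mult.commute)
qed

lemma gauss_fps_quadratic_double:
  "fps_const (of_real (sqrt pi) * 2 powr (1 - 2 * b) * rGamma b) *
   ((gauss_fps p (b - p) (b + 1/2) oo (fps_const (-1/4) * fps_X ^ 2 * neg_binomial_fps 1)) *
     neg_binomial_fps p) =
   gauss_fps (2 * p) b (2 * b)" (is "?L = ?R")
proof (rule fps_ext)
  fix n
  define N e :: nat where "N = n div 2" and "e = n mod 2"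
  have n: "n = 2 * N + e" and e: "e \<le> 1"
    by (auto simp: N_def e_def)
  let ?f = "\<lambda>k. pochhammer p k * pochhammer (b - p) k * rGamma (b + 1/2 + of_nat k) / fact k * (-1/4) ^ k"
  let ?g = "\<lambda>k. if 2 * k \<le> n then pochhammer (p + of_nat k) (n - 2 * k) / fact (n - 2 * k) else 0"
  have "(\<Sum>k\<le>n. ?f k * ?g k) = (\<Sum>k\<le>N. ?f k * ?g k)"
    by (rule sum.mono_neutral_right) (use n e in auto)
  also have "\<dots> = (\<Sum>k\<le>N. ?f k * (pochhammer (p + of_nat k) (2 * (N - k) + e) / fact (2 * (N - k) + e)))"
  proof (intro sum.cong refl)
    fix k assume "k \<in> {..N}"
    then have "2 * k \<le> n" "n - 2 * k = 2 * (N - k) + e"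
      using n by auto
    then show "?f k * ?g k = ?f k * (pochhammer (p + of_nat k) (2 * (N - k) + e) / fact (2 * (N - k) + e))"
      by (simp only: if_True)
  qed
  finally have "(\<Sum>k\<le>n. ?f k * ?g k) * (of_real (sqrt pi) * 2 powr (1 - 2 * b) * rGamma b) =
      pochhammer (2 * p) n * pochhammer b n * rGamma (2 * b + of_nat n) / fact n"
    unfolding n by (simp only: quadratic_coeff_double[OF e])
  then show "fps_nth ?L n = fps_nth ?R n"
    unfolding fps_mult_left_const_nth fps_nth_compose_mult_neg_binomial[OF zero_less_numeral]
    unfolding gauss_fps_def neg_binomial_fps_def fps_nth_Abs_fps mult_1_right
    by (simp only: mult.commute)
qed

lemma eventually_add_of_nat_neq_0:
  fixes c :: complex
  shows "eventually (\<lambda>n. c + of_nat n \<noteq> 0) sequentially"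
  by (rule eventually_mono[OF
        filterlim_at_infinity_imp_eventually_ne[OF
          tendsto_add_filterlim_at_infinity[OF tendsto_const tendsto_of_nat]]]) auto

lemma tendsto_shifted_ratio:
  fixes a c :: complex
  shows "(\<lambda>n. (a + of_nat n) / (c + of_nat n)) \<longlonglongrightarrow> 1"
proof -
  have "(\<lambda>n. 1 + (a - c) / (c + of_nat n)) \<longlonglongrightarrow> 1 + 0"
    by (intro tendsto_add tendsto_const tendsto_divide_0[OF tendsto_const]
        tendsto_add_filterlim_at_infinity[OF tendsto_const] tendsto_of_nat)
  moreover have "eventually (\<lambda>n. c + of_nat n \<noteq> 0) sequentially"
    by (rule eventually_add_of_nat_neq_0)
  then have "eventually (\<lambda>n. 1 + (a - c) / (c + of_nat n) = (a + of_nat n) / (c + of_nat n)) sequentially"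
    by eventually_elim (simp add: field_simps)
  ultimately show ?thesis
    by (auto intro: Lim_transform_eventually)
qed

text \<open>
  The ratio test, in the form with a bound on consecutive terms instead of a limit of their
  quotients, since the series may terminate or start with zeros.
\<close>

lemma fps_conv_radius_gauss: "fps_conv_radius (gauss_fps a b c) \<ge> 1"
  unfolding fps_conv_radius_def
proof (rule conv_radius_geI_ex')
  fix r :: real assume r: "0 < r" "ereal r < 1"
  define u where "u n = fps_nth (gauss_fps a b c) n * of_real r ^ n" for n
  define q where "q n = (a + of_nat n) / (c + of_nat n) * ((b + of_nat n) / (1 + of_nat n)) * of_real r" for n
  have "q \<longlonglongrightarrow> 1 * 1 * of_real r"
    unfolding q_def by (intro tendsto_mult tendsto_shifted_ratio tendsto_const)
  then have "(\<lambda>n. norm (q n)) \<longlonglongrightarrow> r"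
    using r by (auto dest: tendsto_norm)
  then have "eventually (\<lambda>n. norm (q n) < (1 + r) / 2) sequentially"
    using r by (intro order_tendstoD) auto
  moreover have "eventually (\<lambda>n. c + of_nat n \<noteq> 0) sequentially"
    by (rule eventually_add_of_nat_neq_0)
  ultimately have "eventually (\<lambda>n. norm (u (Suc n)) \<le> (1 + r) / 2 * norm (u n)) sequentially"
  proof eventually_elim
    case (elim n)
    have "rGamma (c + of_nat n) = (c + of_nat n) * rGamma (c + of_nat (Suc n))"
      using rGamma_plus1[of "c + of_nat n"] by (simp add: add_ac)
    moreover have "(1 + of_nat n :: complex) \<noteq> 0"
      by (metis of_nat_Suc of_nat_neq_0)
    ultimately have "u (Suc n) = q n * u n"
      using elim by (simp add: u_def q_def gauss_fps_def pochhammer_Suc)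
    then have "norm (u (Suc n)) = norm (q n) * norm (u n)"
      by (simp add: norm_mult)
    also have "\<dots> \<le> (1 + r) / 2 * norm (u n)"
      using elim by (intro mult_right_mono) auto
    finally show ?case .
  qed
  then obtain N where "\<And>n. n \<ge> N \<Longrightarrow> norm (u (Suc n)) \<le> (1 + r) / 2 * norm (u n)"
    by (auto simp: eventually_sequentially)
  then show "summable u"
    using r by (intro summable_ratio_test[of "(1 + r) / 2" N]) auto
qed

section \<open>Continuation to the cut plane\<close>

abbreviation slit_plane :: "complex set" where
  "slit_plane \<equiv> - (complex_of_real ` {1..})"

lemma slit_plane_iff: "z \<in> slit_plane \<longleftrightarrow> 1 - z \<notin> \<real>\<^sub>\<le>\<^sub>0"
proof -
  have "z \<in> complex_of_real ` {1..} \<longleftrightarrow> Im z = 0 \<and> 1 \<le> Re z"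
    by (auto simp: complex_eq_iff intro!: image_eqI[of _ _ "Re z"])
  also have "\<dots> \<longleftrightarrow> 1 - z \<in> \<real>\<^sub>\<le>\<^sub>0"
    by (auto simp: complex_nonpos_Reals_iff)
  finally show ?thesis by simp
qed

lemma open_slit_plane: "open slit_plane"
proof -
  have "slit_plane = (\<lambda>z. 1 - z) -` (- \<real>\<^sub>\<le>\<^sub>0)"
    by (rule set_eqI, unfold slit_plane_iff) simp
  then show ?thesis
    by (auto intro!: open_vimage continuous_intros)
qed

lemma zero_in_slit_plane: "0 \<in> slit_plane"
  by auto

lemma ball_subset_slit_plane: "ball 0 1 \<subseteq> slit_plane"
  by auto

lemma connected_slit_plane: "connected slit_plane"
proof (rule starlike_imp_connected)
  have "closed_segment 0 z \<subseteq> slit_plane" if z: "z \<in> slit_plane" for z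
  proof
    fix w assume "w \<in> closed_segment 0 z"
    then obtain t where t: "0 \<le> t" "t \<le> 1" "w = t *\<^sub>R z"
      by (auto simp: in_segment)
    show "w \<in> slit_plane"
    proof
      assume "w \<in> complex_of_real ` {1..}"
      then obtain r where r: "r \<ge> 1" "t *\<^sub>R z = of_real r"
        using t by auto
      then have "t > 0"
        using t by (cases "t = 0") auto
      then have "z = of_real (r / t)" "r / t \<ge> 1"
        using r t by (auto simp: field_simps scaleR_conv_of_real)
      then have "z \<in> complex_of_real ` {1..}"
        by blast
      with z show False
        by blast
    qed
  qed
  then show "starlike slit_plane"
    unfolding starlike_def using zero_in_slit_plane by blast
qed

text \<open>
  For functions on the cut plane, the sums required on the unit disc may be replaced by an
  expansion near $0$.
\<close>

lemma has_fps_expansion_gauss_iff: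
  assumes "F holomorphic_on slit_plane"
  shows "F has_fps_expansion gauss_fps a b c \<longleftrightarrow>
         (\<forall>z. norm z < 1 \<longrightarrow>
           (\<lambda>k. pochhammer a k * pochhammer b k * rGamma (c + of_nat k) * (z ^ k / fact k)) sums F z)"
proof -
  have eq: "pochhammer a k * pochhammer b k * rGamma (c + of_nat k) * (z ^ k / fact k) =
      fps_nth (gauss_fps a b c) k * z ^ k" for k z
    by (simp add: gauss_fps_def)
  show ?thesis
    unfolding eq
  proof (intro iffI allI impI)
    fix z :: complex
    assume *: "F has_fps_expansion gauss_fps a b c" "norm z < 1"
    show "(\<lambda>k. fps_nth (gauss_fps a b c) k * z ^ k) sums F z"
    proof (rule has_fps_expansion_imp_sums_complex)
      show "F holomorphic_on eball 0 (ereal 1)"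
        using holomorphic_on_subset[OF assms ball_subset_slit_plane] by simp
    qed (use * in simp_all)
  next
    assume *: "\<forall>z. norm z < 1 \<longrightarrow> (\<lambda>k. fps_nth (gauss_fps a b c) k * z ^ k) sums F z"
    have "eventually (\<lambda>z::complex. z \<in> ball 0 1) (nhds 0)"
      by (rule eventually_nhds_in_open) auto
    then show "F has_fps_expansion gauss_fps a b c"
      by (intro has_fps_expansionI, elim eventually_mono) (use * in auto)
  qed
qed

lemma slit_plane_continuation_unique:
  assumes "F holomorphic_on slit_plane" "G holomorphic_on slit_plane"
    and "F has_fps_expansion f" "G has_fps_expansion f" "z \<in> slit_plane"
  shows "F z = G z"
proof -
  have "eventually (\<lambda>z. F z = G z) (nhds 0)"
    using assms(3,4) unfolding has_fps_expansion_def by (auto elim: eventually_elim2)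
  then obtain S where S: "open S" "0 \<in> S" "\<And>z. z \<in> S \<Longrightarrow> F z = G z"
    unfolding eventually_nhds by blast
  show ?thesis
  proof (rule analytic_continuation_open[of "S \<inter> slit_plane" slit_plane F G])
    show "open (S \<inter> slit_plane)"
      using S(1) open_slit_plane by (rule open_Int)
    show "S \<inter> slit_plane \<noteq> {}"
      using S(2) zero_in_slit_plane by blast
    show "F w = G w" if "w \<in> S \<inter> slit_plane" for w
      using S(3) that by blast
  qed (use assms open_slit_plane connected_slit_plane in blast)+
qed

text \<open>
  Any continuation of the Gauss series shows that the choice in \<open>hyp2F1_olver\<close> succeeds,
  and then the identity theorem makes it equal to the chosen function.
\<close>

lemma
  assumes "F holomorphic_on slit_plane" "F has_fps_expansion gauss_fps a b c"
  shows hyp2F1_olver_holomorphic: "hyp2F1_olver a b c holomorphic_on slit_plane"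
    and hyp2F1_olver_has_fps_expansion: "hyp2F1_olver a b c has_fps_expansion gauss_fps a b c"
    and hyp2F1_olver_eqI: "z \<in> slit_plane \<Longrightarrow> hyp2F1_olver a b c z = F z"
proof -
  let ?P = "\<lambda>F. F holomorphic_on slit_plane \<and> F has_fps_expansion gauss_fps a b c"
  have "hyp2F1_olver a b c = (SOME F. ?P F)"
    unfolding hyp2F1_olver_def
    by (intro arg_cong[where f = Eps] ext conj_cong refl) (simp only: has_fps_expansion_gauss_iff)
  then have *: "?P (hyp2F1_olver a b c)"
    using someI[of ?P F] assms by simp
  then show "hyp2F1_olver a b c holomorphic_on slit_plane"
    "hyp2F1_olver a b c has_fps_expansion gauss_fps a b c"
    by auto
  show "hyp2F1_olver a b c z = F z" if "z \<in> slit_plane"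
    using slit_plane_continuation_unique[of "hyp2F1_olver a b c" F] * assms that by blast
qed

lemma square_notin_nonpos_Reals:
  assumes "0 < Re w"
  shows "w\<^sup>2 \<notin> \<real>\<^sub>\<le>\<^sub>0"
proof
  assume "w\<^sup>2 \<in> \<real>\<^sub>\<le>\<^sub>0"
  then have "Re w * Re w - Im w * Im w \<le> 0" "Re w * Im w = 0"
    by (auto simp: complex_nonpos_Reals_iff power2_eq_square)
  with assms show False
    by (auto simp: mult_le_0_iff)
qed

lemma Re_pos_imp_add_one_neq_0: "0 < Re w \<Longrightarrow> w + 1 \<noteq> 0"
  by (auto simp: complex_eq_iff)

lemma Re_csqrt_pos:
  assumes "w \<notin> \<real>\<^sub>\<le>\<^sub>0"
  shows "0 < Re (csqrt w)"
proof (rule ccontr)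
  assume "\<not> 0 < Re (csqrt w)"
  then have "Re (csqrt w) = 0"
    using Re_csqrt[of w] by linarith
  then have "(csqrt w)\<^sup>2 \<in> \<real>\<^sub>\<le>\<^sub>0"
    by (simp add: complex_nonpos_Reals_iff power2_eq_square)
  with assms show False
    by simp
qed

lemma Re_csqrt_one_minus_pos: "z \<in> slit_plane \<Longrightarrow> 0 < Re (csqrt (1 - z))"
  unfolding slit_plane_iff by (rule Re_csqrt_pos)

text \<open>
  The inverse of the conformal map $s\mapsto-4s/(1-s)^2$ from the unit disc onto the cut plane, a
  rescaled Koebe function.
\<close>

definition disc_coordinate :: "complex \<Rightarrow> complex" where
  "disc_coordinate z = (csqrt (1 - z) - 1) / (csqrt (1 - z) + 1)"

lemma
  assumes "z \<in> slit_plane"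
  shows norm_disc_coordinate: "norm (disc_coordinate z) < 1"
    and koebe_disc_coordinate: "- 4 * disc_coordinate z / (1 - disc_coordinate z)\<^sup>2 = z"
proof -
  define w where "w = csqrt (1 - z)"
  have w: "0 < Re w" "w\<^sup>2 = 1 - z"
    using Re_csqrt_one_minus_pos[OF assms] by (simp_all add: w_def)
  have nz: "w + 1 \<noteq> 0"
    using w(1) by (rule Re_pos_imp_add_one_neq_0)
  have "(norm (w - 1))\<^sup>2 < (norm (w + 1))\<^sup>2"
    unfolding cmod_power2 using w(1) by (simp add: power2_eq_square algebra_simps)
  then have "norm (w - 1) < norm (w + 1)"
    by (rule power_less_imp_less_base) simp
  then show "norm (disc_coordinate z) < 1"
    unfolding disc_coordinate_def w_def[symmetric] using nz by (simp add: norm_divide)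
  have quot: "- 4 * ((w - 1) / t) / (2 / t)\<^sup>2 = - ((w - 1) * t)" if "t \<noteq> 0" for t
    using that by (simp add: divide_simps power2_eq_square) (simp add: algebra_simps)
  have "1 - disc_coordinate z = 2 / (w + 1)"
    unfolding disc_coordinate_def w_def[symmetric] using nz by (simp add: field_simps)
  then have "- 4 * disc_coordinate z / (1 - disc_coordinate z)\<^sup>2 = - ((w - 1) * (w + 1))"
    unfolding disc_coordinate_def w_def[symmetric] using quot[OF nz] by simp
  also have "\<dots> = z"
    using w(2) by (simp add: algebra_simps power2_eq_square)
  finally show "- 4 * disc_coordinate z / (1 - disc_coordinate z)\<^sup>2 = z" .
qed

lemma holomorphic_disc_coordinate: "disc_coordinate holomorphic_on slit_plane"
proof -
  have "csqrt (1 - z) + 1 \<noteq> 0" if "z \<in> slit_plane" for z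
    using Re_pos_imp_add_one_neq_0[OF Re_csqrt_one_minus_pos[OF that]] .
  then show ?thesis
    unfolding disc_coordinate_def by (intro holomorphic_intros) (simp_all only: slit_plane_iff not_False_eq_True)
qed

lemma has_fps_expansion_koebe:
  "(\<lambda>z. q * z ^ m / (1 - z) ^ n) has_fps_expansion fps_const q * fps_X ^ m * neg_binomial_fps (of_nat n :: complex)"
proof -
  have exp: "(\<lambda>z. q * z ^ m * (1 - z) powr (- of_nat n)) has_fps_expansion
      fps_const q * fps_X ^ m * neg_binomial_fps (of_nat n :: complex)"
    by (intro has_fps_expansion_mult has_fps_expansion_const has_fps_expansion_fps_X_power
        has_fps_expansion_neg_binomial)
  have "eventually (\<lambda>z::complex. z \<noteq> 1) (nhds 0)"
    by (rule t1_space_nhds) simp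
  then have ev: "eventually (\<lambda>z. q * z ^ m * (1 - z) powr (- of_nat n) = q * z ^ m / (1 - z) ^ n) (nhds 0)"
    by eventually_elim (simp add: powr_minus powr_nat' divide_inverse)
  show ?thesis
    using has_fps_expansion_cong[OF ev refl] exp by (rule iffD1)
qed

text \<open>
  The Gauss series $G(s)={}_2\mathbf F_1(2A,A-B+\frac12;A+B+\frac12;s)$ converges on the whole
  unit disc, so $(1-s)^{2A}\,G(s)$, read in the disc coordinate, is defined on the whole cut plane.
  Near $0$ it is the required series by \<open>gauss_fps_quadratic\<close>.
\<close>

lemma gauss_continuation_exists:
  "\<exists>F. F holomorphic_on slit_plane \<and> F has_fps_expansion gauss_fps A B (A + B + 1/2)"
proof -
  define f where "f = gauss_fps A B (A + B + 1/2)"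
  define G where "G = eval_fps (gauss_fps (2 * A) (A - B + 1/2) (A + B + 1/2))"
  define F where "F z = G (disc_coordinate z) * (1 - disc_coordinate z) powr (2 * A)" for z
  have f: "eval_fps f has_fps_expansion f"
    unfolding f_def using fps_conv_radius_gauss
    by (intro eval_fps_has_fps_expansion) (auto intro: less_le_trans[of 0 "1 :: ereal"])
  have G: "G has_fps_expansion gauss_fps (2 * A) (A - B + 1/2) (A + B + 1/2)"
    unfolding G_def using fps_conv_radius_gauss
    by (intro eval_fps_has_fps_expansion) (auto intro: less_le_trans[of 0 "1 :: ereal"])
  have G_holo: "G holomorphic_on ball 0 1"
    unfolding G_def
    by (intro holomorphic_on_eval_fps) (auto intro!: less_le_trans[OF _ fps_conv_radius_gauss])
  have "F holomorphic_on slit_plane"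
    unfolding F_def
  proof (intro holomorphic_intros holomorphic_disc_coordinate)
    show "(\<lambda>z. G (disc_coordinate z)) holomorphic_on slit_plane"
      using holomorphic_on_compose_gen[OF holomorphic_disc_coordinate G_holo]
        image_subsetI[of slit_plane disc_coordinate "ball 0 1"] norm_disc_coordinate
      unfolding o_def mem_ball_0 by blast
    fix z assume "z \<in> slit_plane"
    then have "Re (disc_coordinate z) < 1"
      using norm_disc_coordinate[of z] complex_Re_le_cmod[of "disc_coordinate z"] by linarith
    then show "1 - disc_coordinate z \<notin> \<real>\<^sub>\<le>\<^sub>0"
      by (auto simp: complex_nonpos_Reals_iff)
  qed
  moreover have "F has_fps_expansion f"
  proof -
    have "((\<lambda>s. (eval_fps f \<circ> (\<lambda>z. -4 * z ^ 1 / (1 - z) ^ 2)) s * (1 - s) powr (- (2 * A))))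
        has_fps_expansion (f oo (fps_const (-4) * fps_X ^ 1 * neg_binomial_fps (of_nat 2))) * neg_binomial_fps (2 * A)"
      by (intro has_fps_expansion_mult has_fps_expansion_compose f has_fps_expansion_koebe
          has_fps_expansion_neg_binomial) simp
    also have "(f oo (fps_const (-4) * fps_X ^ 1 * neg_binomial_fps (of_nat 2))) * neg_binomial_fps (2 * A) =
        gauss_fps (2 * A) (A - B + 1/2) (A + B + 1/2)"
      unfolding f_def using gauss_fps_quadratic[of A B] by (simp only: of_nat_numeral)
    finally have *: "eventually (\<lambda>s. eval_fps f (-4 * s / (1 - s)\<^sup>2) * (1 - s) powr (- (2 * A)) = G s) (nhds 0)"
      using G unfolding has_fps_expansion_def by (auto elim: eventually_elim2 simp: o_def)
    have "isCont disc_coordinate 0"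
      using holomorphic_on_imp_continuous_on[OF holomorphic_disc_coordinate] open_slit_plane
        zero_in_slit_plane by (simp add: continuous_on_eq_continuous_at)
    moreover have "disc_coordinate 0 = 0"
      by (simp add: disc_coordinate_def)
    ultimately have "filterlim disc_coordinate (nhds 0) (nhds 0)"
      by (metis isCont_def tendsto_nhds_iff)
    then have "eventually (\<lambda>z. eval_fps f (-4 * disc_coordinate z / (1 - disc_coordinate z)\<^sup>2) *
        (1 - disc_coordinate z) powr (- (2 * A)) = G (disc_coordinate z)) (nhds 0)"
      using * by (rule eventually_compose_filterlim[rotated])
    moreover have "eventually (\<lambda>z. z \<in> slit_plane) (nhds 0)"
      by (rule eventually_nhds_in_open[OF open_slit_plane zero_in_slit_plane])
    ultimately have ev: "eventually (\<lambda>z. eval_fps f z = F z) (nhds 0)"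
    proof eventually_elim
      case (elim z)
      have "1 - disc_coordinate z \<noteq> 0"
        using norm_disc_coordinate[OF elim(2)] by auto
      then show ?case
        using elim(1) unfolding koebe_disc_coordinate[OF elim(2)]
        by (simp add: F_def powr_minus field_simps)
    qed
    show ?thesis
      using has_fps_expansion_cong[OF ev refl] f by (rule iffD1)
  qed
  ultimately show ?thesis
    by (auto simp: f_def)
qed

lemma
  shows hyp2F1_olver_half_holomorphic: "hyp2F1_olver A B (A + B + 1/2) holomorphic_on slit_plane"
    and hyp2F1_olver_half_has_fps_expansion: "hyp2F1_olver A B (A + B + 1/2) has_fps_expansion gauss_fps A B (A + B + 1/2)"
  using gauss_continuation_exists[of A B] hyp2F1_olver_holomorphic hyp2F1_olver_has_fps_expansion
  by blast+

section \<open>Transformations on the cut plane\<close>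

text \<open>
  The right-hand side continues the series for $(a,b,c)$, so existence of the continuation
  is needed only for $(c-a,c-b,c)$.
\<close>

lemma hyp2F1_olver_euler:
  assumes "F holomorphic_on slit_plane" "F has_fps_expansion gauss_fps (c - a) (c - b) c" "z \<in> slit_plane"
  shows "hyp2F1_olver a b c z = (1 - z) powr (c - a - b) * F z"
proof (rule hyp2F1_olver_eqI[OF _ _ assms(3)])
  show "(\<lambda>z. (1 - z) powr (c - a - b) * F z) holomorphic_on slit_plane"
    using assms(1) by (intro holomorphic_intros) (simp_all only: slit_plane_iff not_False_eq_True)
  have "(\<lambda>z. F z * (1 - z) powr (- (a + b - c))) has_fps_expansion
      gauss_fps (c - a) (c - b) c * neg_binomial_fps (a + b - c)"
    by (intro has_fps_expansion_mult assms has_fps_expansion_neg_binomial)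
  then show "(\<lambda>z. (1 - z) powr (c - a - b) * F z) has_fps_expansion gauss_fps a b c"
    unfolding gauss_fps_euler by (simp add: algebra_simps)
qed

text \<open>
  With $v=\sqrt{1-z}$, one minus the argument is the square of $(v+v^{-1})/2$, which lies in the
  right half-plane together with $v$.
\<close>

lemma quadratic_argument_slit_plane:
  assumes "z \<in> slit_plane"
  shows "- (1/4) * z\<^sup>2 / (1 - z) \<in> slit_plane"
proof -
  define v where "v = csqrt (1 - z)"
  have v: "0 < Re v" "v\<^sup>2 = 1 - z"
    using Re_csqrt_one_minus_pos[OF assms] by (simp_all add: v_def)
  have nz: "v \<noteq> 0"
    using v(1) by auto
  have z: "z = 1 - v\<^sup>2"
    using v(2) by simp
  define u where "u = (v + inverse v) / 2"
  have "1 - (- (1/4) * z\<^sup>2 / (1 - z)) = u\<^sup>2"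
    unfolding z u_def using nz by (simp add: field_simps power2_eq_square)
  moreover have "0 < Re u"
    using v(1) by (auto simp: u_def inverse_complex.simps intro!: add_pos_nonneg divide_nonneg_nonneg)
  then have "u\<^sup>2 \<notin> \<real>\<^sub>\<le>\<^sub>0"
    by (rule square_notin_nonpos_Reals)
  ultimately show ?thesis
    by (simp only: slit_plane_iff not_False_eq_True)
qed

text \<open>
  Gauss's quadratic transformation on the whole cut plane. The right-hand side is holomorphic there
  because its argument stays in the cut plane, and it has the right coefficients at $0$.
\<close>

theorem hyp2F1_olver_quadratic_double:
  assumes "z \<in> slit_plane"
  shows "hyp2F1_olver (2 * p) b (2 * b) z =
     of_real (sqrt pi) * 2 powr (1 - 2 * b) * rGamma b * (1 - z) powr (- p) *
     hyp2F1_olver p (b - p) (b + 1/2) (- (1/4) * z\<^sup>2 / (1 - z))"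
proof -
  define H where "H = hyp2F1_olver p (b - p) (b + 1/2)"
  define K where "K = of_real (sqrt pi) * 2 powr (1 - 2 * b) * rGamma b"
  define h :: "complex \<Rightarrow> complex" where "h z = -(1/4) * z ^ 2 / (1 - z) ^ 1" for z
  have H: "H holomorphic_on slit_plane" "H has_fps_expansion gauss_fps p (b - p) (b + 1/2)"
    using hyp2F1_olver_half_holomorphic[of p "b - p"] hyp2F1_olver_half_has_fps_expansion[of p "b - p"]
    by (simp_all add: H_def)
  have "hyp2F1_olver (2 * p) b (2 * b) z = K * ((H \<circ> h) z * (1 - z) powr (- p))"
  proof (rule hyp2F1_olver_eqI[OF _ _ assms])
    have "h holomorphic_on slit_plane"
      unfolding h_def by (intro holomorphic_intros) (auto simp: image_iff intro!: bexI[of _ 1])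
    moreover have "h ` slit_plane \<subseteq> slit_plane"
      using quadratic_argument_slit_plane by (auto simp: h_def)
    ultimately have "(H \<circ> h) holomorphic_on slit_plane"
      using H(1) holomorphic_on_compose_gen by blast
    then show "(\<lambda>z. K * ((H \<circ> h) z * (1 - z) powr (- p))) holomorphic_on slit_plane"
      by (intro holomorphic_intros) (simp_all only: slit_plane_iff not_False_eq_True)
    have "(\<lambda>z. K * ((H \<circ> h) z * (1 - z) powr (- p))) has_fps_expansion fps_const K *
       ((gauss_fps p (b - p) (b + 1/2) oo
         (fps_const (-(1/4)) * fps_X ^ 2 * neg_binomial_fps (of_nat 1))) * neg_binomial_fps p)"
      unfolding h_def
      by (intro has_fps_expansion_mult has_fps_expansion_const has_fps_expansion_compose H
          has_fps_expansion_koebe has_fps_expansion_neg_binomial) simp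
    then show "(\<lambda>z. K * ((H \<circ> h) z * (1 - z) powr (- p))) has_fps_expansion gauss_fps (2 * p) b (2 * b)"
      using gauss_fps_quadratic_double[of b p] by (simp add: K_def)
  qed
  then show ?thesis
    by (simp add: H_def K_def h_def mult_ac)
qed

section \<open>Branches of the Jacobi function\<close>

text \<open>
  The Moebius map $z\mapsto(z+1)/(z-1)$ takes $[-1,1)$ onto $(-\infty,0]$. It is one minus the
  hypergeometric argument $2/(1-z)$, so this identifies the domain of the Jacobi function with the
  cut plane.
\<close>

lemma closed_segment_iff_quotient:
  "z \<in> closed_segment (-1) (1 :: complex) \<longleftrightarrow> z = 1 \<or> (z + 1) / (z - 1) \<in> \<real>\<^sub>\<le>\<^sub>0"
proof -
  have seg: "z \<in> closed_segment (-1) 1 \<longleftrightarrow> (\<exists>x\<in>{-1..1}. z = complex_of_real x)"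
    using closed_segment_of_real[of "-1" 1, where ?'a = complex]
    by (auto simp: closed_segment_eq_real_ivl)
  show ?thesis
  proof (cases "z = 1")
    case False
    show ?thesis
    proof
      assume "z \<in> closed_segment (-1) 1"
      then obtain x where x: "-1 \<le> x" "x \<le> 1" "z = of_real x"
        using seg by auto
      then have "x < 1"
        using False by (cases "x = 1") auto
      then have "(x + 1) / (x - 1) \<le> 0"
        using x by (intro divide_nonneg_neg) auto
      moreover have "(z + 1) / (z - 1) = of_real ((x + 1) / (x - 1))"
        using x by simp
      ultimately show "z = 1 \<or> (z + 1) / (z - 1) \<in> \<real>\<^sub>\<le>\<^sub>0"
        by (metis nonpos_Reals_of_real_iff)
    next
      assume "z = 1 \<or> (z + 1) / (z - 1) \<in> \<real>\<^sub>\<le>\<^sub>0"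
      then obtain t where t: "t \<le> 0" "(z + 1) / (z - 1) = complex_of_real t"
        using False by (auto elim: nonpos_Reals_cases)
      then have "(z + 1) = of_real t * (z - 1)"
        using False by (simp add: field_simps)
      then have "z * of_real (1 - t) = - of_real (1 + t)"
        by (simp add: algebra_simps)
      moreover have "complex_of_real (1 - t) \<noteq> 0"
        using t by (simp only: of_real_eq_0_iff)
      ultimately have "z = - of_real (1 + t) / of_real (1 - t)"
        by (metis nonzero_eq_divide_eq)
      then have "z = of_real (- (1 + t) / (1 - t))"
        by (simp only: of_real_divide of_real_minus)
      moreover have "- 1 \<le> - (1 + t) / (1 - t)" "- (1 + t) / (1 - t) \<le> 1"
        using t by (auto simp: field_simps)
      ultimately show "z \<in> closed_segment (-1) 1"
        unfolding seg by (intro bexI[of _ "- (1 + t) / (1 - t)"]) (simp_all only: atLeastAtMost_iff simp_thms)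
    qed
  qed auto
qed


lemma one_minus_quotient:
  fixes z :: complex
  assumes "z \<noteq> 1"
  shows "1 - 2 / (1 - z) = (z + 1) / (z - 1)"
  using assms by (simp add: divide_simps) (simp add: algebra_simps)

lemma jacobi_argument_in_slit_plane:
  assumes "z \<notin> closed_segment (-1) 1"
  shows "2 / (1 - z) \<in> slit_plane"
  using assms unfolding slit_plane_iff closed_segment_iff_quotient
  by (simp only: one_minus_quotient de_Morgan_disj not_False_eq_True)

text \<open>
  The argument $\xi$ produced by the quadratic transformation at $\zeta=2/(1-z)$ is the argument
  that belongs to $w=2z^2-1$.
\<close>

lemma quadratic_argument:
  fixes z :: complex
  assumes "z \<noteq> 1" "z \<noteq> -1"
  shows "- (1/4) * (2 / (1 - z))\<^sup>2 / (1 - 2 / (1 - z)) = 2 / (1 - (2 * z\<^sup>2 - 1))"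
proof -
  have nz: "z - 1 \<noteq> 0" "z + 1 \<noteq> 0"
    using assms by (auto simp: add_eq_0_iff2)
  have "1 - (2 * z\<^sup>2 - 1) = - 2 * ((z - 1) * (z + 1))" "2 / (1 - z) = - 2 / (z - 1)"
    using nz by (simp_all add: algebra_simps power2_eq_square divide_simps)
  moreover have "- (1/4) * (- 2 / a)\<^sup>2 / (b / a) = 2 / (- 2 * (a * b))" if "a \<noteq> 0" "b \<noteq> 0" for a b :: complex
    using that by (simp add: field_simps power2_eq_square)
  ultimately show ?thesis
    unfolding one_minus_quotient[OF assms(1)] using nz by (simp only:)
qed

lemma quadratic_in_cut:
  assumes z: "z \<notin> closed_segment (-1) (1 :: complex)"
  shows "2 * z\<^sup>2 - 1 \<notin> closed_segment (-1) 1"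
proof -
  have nz: "z \<noteq> 1" "z \<noteq> -1"
    using not_in_cut_neq[OF z] .
  then have "z\<^sup>2 \<noteq> 1"
    by (simp add: power2_eq_1_iff)
  moreover have "2 / (1 - (2 * z\<^sup>2 - 1)) \<in> slit_plane"
    using quadratic_argument_slit_plane[OF jacobi_argument_in_slit_plane[OF z]]
    unfolding quadratic_argument[OF nz] .
  ultimately show ?thesis
    unfolding closed_segment_iff_quotient slit_plane_iff by (subst (asm) one_minus_quotient) auto
qed

text \<open>
  $\sqrt{z-1}\sqrt{z+1}\sqrt{(w+1)/(w-1)}=z$ for the continued square roots. The squares agree, so
  only the sign is in question. With the principal root $v$ of $(z+1)/(z-1)$, the left-hand side is
  $(z-1)\,v\,s$ for the principal root $s$ of $(w+1)/(w-1)$, and that root is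
  $(v+v^{-1})/2$ because this has positive real part.
\<close>

lemma exp_half_log_sum:
  assumes z: "z \<notin> closed_segment (-1) 1" and l: "exp l = z - 1"
  defines "w \<equiv> 2 * z\<^sup>2 - 1"
  shows "exp ((l + log_succ l z + Ln ((w + 1) / (w - 1))) / 2) = z"
proof -
  define u v where "u = (z + 1) / (z - 1)" and "v = csqrt u"
  have nz: "z - 1 \<noteq> 0" "z + 1 \<noteq> 0"
    using not_in_cut_neq[OF z] by (auto simp: add_eq_0_iff2)
  have "u \<noteq> 0"
    using nz by (simp add: u_def)
  have u: "u \<notin> \<real>\<^sub>\<le>\<^sub>0"
    using z unfolding closed_segment_iff_quotient u_def by simp
  then have v: "0 < Re v" "v\<^sup>2 = u"
    using Re_csqrt_pos by (simp_all add: v_def)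
  then have "v \<noteq> 0"
    by auto
  define s where "s = (v + inverse v) / 2"
  have "z * (v\<^sup>2 - 1) = v\<^sup>2 + 1"
    unfolding v(2) u_def using nz by (simp add: field_simps)
  then have zs: "z = (z - 1) * v * s"
    unfolding s_def using \<open>v \<noteq> 0\<close> by (simp add: field_simps power2_eq_square)
  have w_pm: "w + 1 = 2 * z\<^sup>2" "w - 1 = 2 * ((z - 1) * (z + 1))"
    by (simp_all add: w_def algebra_simps power2_eq_square)
  have "(w + 1) / (w - 1) = z\<^sup>2 / ((z - 1) * (z + 1))"
    unfolding w_pm by simp
  also have "(z - 1) * (z + 1) = (z - 1)\<^sup>2 * v\<^sup>2"
    unfolding v(2) u_def using nz by (simp add: power2_eq_square)
  also have "z\<^sup>2 / ((z - 1)\<^sup>2 * v\<^sup>2) = s\<^sup>2"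
    by (subst zs) (use nz \<open>v \<noteq> 0\<close> in \<open>simp add: power_mult_distrib\<close>)
  finally have ws: "(w + 1) / (w - 1) = s\<^sup>2" .
  have "0 < Re s"
    using v(1) by (auto simp: s_def inverse_complex.simps intro!: add_pos_nonneg divide_nonneg_nonneg)
  then have "csqrt (s\<^sup>2) = s"
    by (intro csqrt_square) auto
  moreover have "s \<noteq> 0"
    using \<open>0 < Re s\<close> by auto
  ultimately have "exp (Ln (s\<^sup>2) / 2) = s"
    by (simp add: csqrt_exp_Ln)
  moreover have "exp (Ln u / 2) = v"
    using \<open>u \<noteq> 0\<close> by (simp add: v_def csqrt_exp_Ln)
  moreover have "(l + log_succ l z + Ln ((w + 1) / (w - 1))) / 2 = l + Ln u / 2 + Ln (s\<^sup>2) / 2"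
    unfolding ws log_succ_def u_def by (simp add: field_simps)
  ultimately show ?thesis
    using l zs by (simp only: exp_add)
qed

text \<open>
  On this half of the plane the principal logarithms of $z-1$ and $z+1$ add up without leaving
  $(-\pi,\pi]$. For real $z$ both are real. Otherwise their imaginary parts have the sign of
  $\mathrm{Im}\,z$ and modulus below $\pi$, so the sine of a sum outside this interval would
  contradict the sign of $\mathrm{Im}(z^2-1)=2\,\mathrm{Re}\,z\,\mathrm{Im}\,z$.
\<close>

lemma lift_quad_Ln:
  assumes z: "z \<notin> closed_segment (-1) (1 :: complex)" and Re: "Re z > 0 \<or> Re z = 0 \<and> Im z > 0"
  shows "lift_quad (Ln (z - 1)) z = Ln (2 * z\<^sup>2 - 1 - 1)"
proof -
  have nz: "z - 1 \<noteq> 0" "z + 1 \<noteq> 0"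
    using not_in_cut_neq[OF z] by (auto simp: add_eq_0_iff2)
  define S where "S = Ln (z - 1) + Ln (z + 1)"
  have eq: "lift_quad (Ln (z - 1)) z = Ln 2 + S"
    by (simp add: lift_quad_def log_succ_Ln[OF z] S_def)
  have "exp S = z\<^sup>2 - 1"
    using nz by (simp add: S_def exp_add algebra_simps power2_eq_square)
  then have "exp (Re S) * sin (Im S) = 2 * (Re z * Im z)"
    by (simp flip: Im_exp) (simp add: power2_eq_square)
  then have sin_S: "sin (Im S) = 2 * (Re z * Im z) / exp (Re S)"
    by (simp add: field_simps)
  have "- pi < Im S \<and> Im S \<le> pi"
  proof (cases "Im z" "0 :: real" rule: linorder_cases)
    case greater
    then have "0 < Im S" "Im S < 2 * pi"
      using Im_Ln_pos_lt_imp[of "z + 1"] Im_Ln_pos_lt_imp[of "z - 1"] by (auto simp: S_def)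
    moreover have "0 \<le> sin (Im S)"
      unfolding sin_S using greater Re by auto
    ultimately show ?thesis
      using sin_lt_zero[of "Im S"] pi_gt_zero by linarith
  next
    case less
    then have "Im (Ln (z + 1)) < 0" "Im (Ln (z - 1)) < 0"
      using Im_Ln_pos_le[of "z + 1"] Im_Ln_pos_le[of "z - 1"]
        Im_Ln_le_pi[of "z + 1"] Im_Ln_le_pi[of "z - 1"] nz by auto
    then have "Im S < 0" "- (2 * pi) < Im S"
      using mpi_less_Im_Ln[of "z + 1"] mpi_less_Im_Ln[of "z - 1"] nz by (auto simp: S_def)
    moreover have "sin (Im S + 2 * pi) < 0"
      unfolding sin_periodic sin_S using less Re by (auto simp: divide_less_0_iff mult_less_0_iff)
    ultimately show ?thesis
      using sin_ge_zero[of "Im S + 2 * pi"] pi_gt_zero by linarith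
  next
    case equal
    then have "Re z > 0"
      using Re by auto
    have "\<not> Re z \<le> 1"
    proof
      assume "Re z \<le> 1"
      then have "(z + 1) / (z - 1) = of_real ((Re z + 1) / (Re z - 1))" "(Re z + 1) / (Re z - 1) \<le> 0"
        using equal \<open>Re z > 0\<close> by (auto simp: complex_eq_iff divide_nonneg_nonpos Re_divide Im_divide power2_eq_square)
      then show False
        using z unfolding closed_segment_iff_quotient by (metis nonpos_Reals_of_real_iff)
    qed
    then have "Im (Ln (z + 1)) = 0" "Im (Ln (z - 1)) = 0"
      using equal nz by (auto simp: Im_Ln_eq_0)
    then show ?thesis
      by (simp add: S_def)
  qed
  moreover have "exp (Ln 2 + S) = 2 * z\<^sup>2 - 1 - 1"
    unfolding exp_add \<open>exp S = z\<^sup>2 - 1\<close> by simp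
  moreover have "Im (Ln 2) = 0"
    by (simp add: Im_Ln_eq_0)
  ultimately show ?thesis
    unfolding eq by (intro Ln_unique[symmetric]) auto
qed

lemma gauss_fps_commute: "gauss_fps a b c = gauss_fps b a c"
  by (simp add: gauss_fps_def mult.commute)

text \<open>
  The quadratic transformation with $p=\gamma+1$ and $b=\alpha+2\gamma+2$. All powers are
  collected into a single exponential on either side, so that equality of the exponents is linear
  algebra in the logarithms of $2$, $z-1$, $z+1$ and $(w+1)/(w-1)$.
\<close>

lemma jacobi_Q_at_quadratic_odd:
  fixes z l \<alpha> \<gamma> :: complex
  assumes z: "z \<notin> closed_segment (-1) 1" and l: "exp l = z - 1"
    and G: "Gamma (\<gamma> + 3/2) \<noteq> 0" "Gamma (\<alpha> + \<gamma> + 1) \<noteq> 0"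
  shows "jacobi_Q_at l (2 * \<gamma> + 1) \<alpha> \<alpha> z =
            of_real (sqrt pi) * Gamma (\<alpha> + 2 * \<gamma> + 2) * z /
            (2 powr (2 * \<gamma> + 1) * Gamma (\<gamma> + 3 / 2) * Gamma (\<alpha> + \<gamma> + 1)) *
            jacobi_Q_at (lift_quad l z) \<gamma> \<alpha> (1 / 2) (2 * z\<^sup>2 - 1)"
proof -
  define w where "w = 2 * z\<^sup>2 - 1"
  define b where "b = \<alpha> + 2 * \<gamma> + 2"
  define m where "m = log_succ l z"
  define t :: complex where "t = Ln 2"
  define s where "s = Ln ((w + 1) / (w - 1))"
  define X where "X = hyp2F1_olver (\<gamma> + 1) (\<alpha> + \<gamma> + 1) (b + 1/2) (2 / (1 - w))"
  have nz: "z \<noteq> 1" "z \<noteq> -1"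
    using not_in_cut_neq[OF z] .
  have u: "(z + 1) / (z - 1) \<noteq> 0"
    using nz by (auto simp: add_eq_0_iff2)
  have ml: "m - l = Ln ((z + 1) / (z - 1))"
    by (simp add: m_def log_succ_def)
  have zexp: "z = exp ((l + m + s) / 2)"
    using exp_half_log_sum[OF z l] by (simp add: w_def m_def s_def)
  have "hyp2F1_olver (2 * (\<gamma> + 1)) b (2 * b) (2 / (1 - z)) =
      of_real (sqrt pi) * 2 powr (1 - 2 * b) * rGamma b * exp (- (\<gamma> + 1) * (m - l)) * X"
    unfolding hyp2F1_olver_quadratic_double[OF jacobi_argument_in_slit_plane[OF z]]
      quadratic_argument[OF nz]
    unfolding one_minus_quotient[OF nz(1)] powr_def ml
    using u by (simp add: X_def w_def b_def algebra_simps)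
  then have "jacobi_Q_at l (2 * \<gamma> + 1) \<alpha> \<alpha> z =
      exp ((2 * \<alpha> + 2 * \<gamma> + 1) * t) * Gamma b * Gamma b / (exp (b * l) * exp (\<alpha> * m)) *
      (of_real (sqrt pi) * exp ((1 - 2 * b) * t) * rGamma b * exp (- (\<gamma> + 1) * (m - l)) * X)"
    by (simp add: jacobi_Q_at_def b_def m_def t_def powr_def algebra_simps)
  also have "\<dots> = of_real (sqrt pi) * (Gamma b * Gamma b * rGamma b) * X *
      (exp ((2 * \<alpha> + 2 * \<gamma> + 1) * t) / (exp (b * l) * exp (\<alpha> * m)) * exp ((1 - 2 * b) * t) *
       exp (- (\<gamma> + 1) * (m - l)))"
    by simp
  also have "Gamma b * Gamma b * rGamma b = Gamma b"
    by (cases "Gamma b = 0") (simp_all add: rGamma_inverse_Gamma)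
  also have "exp ((2 * \<alpha> + 2 * \<gamma> + 1) * t) / (exp (b * l) * exp (\<alpha> * m)) * exp ((1 - 2 * b) * t) *
       exp (- (\<gamma> + 1) * (m - l)) =
       exp (- (2 * \<gamma> + 2) * t - (\<alpha> + \<gamma> + 1) * (l + m))"
    unfolding exp_add[symmetric] exp_diff[symmetric]
    by (rule arg_cong[where f = exp]) (simp add: b_def algebra_simps)
  also have "\<dots> = exp ((l + m + s) / 2) * exp ((\<alpha> + 1/2 + \<gamma>) * t) / (exp ((2 * \<gamma> + 1) * t) *
      (exp ((\<alpha> + \<gamma> + 1) * (t + l + m)) * exp (1/2 * (t + l + m + s))))"
    unfolding exp_add[symmetric] exp_diff[symmetric]
    by (rule arg_cong[where f = exp]) (simp add: field_simps)
  finally have "jacobi_Q_at l (2 * \<gamma> + 1) \<alpha> \<alpha> z = of_real (sqrt pi) * Gamma b * X * \<dots>" .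
  moreover have "jacobi_Q_at (lift_quad l z) \<gamma> \<alpha> (1/2) w =
      exp ((\<alpha> + 1/2 + \<gamma>) * t) * Gamma (\<alpha> + \<gamma> + 1) * Gamma (\<gamma> + 3/2) /
      (exp ((\<alpha> + \<gamma> + 1) * (t + l + m)) * exp (1/2 * (t + l + m + s))) * X"
  proof -
    have "log_succ (lift_quad l z) w = t + l + m + s" "lift_quad l z = t + l + m"
      by (simp_all add: log_succ_def lift_quad_def t_def m_def s_def)
    moreover have "\<alpha> + 1/2 + 2 * \<gamma> + 2 = b + 1/2" "1/2 + \<gamma> + 1 = \<gamma> + 3/2"
      by (simp_all add: b_def)
    ultimately show ?thesis
      unfolding jacobi_Q_at_def by (simp only: X_def powr_def t_def) simp
  qed
  ultimately show ?thesis
    unfolding w_def[symmetric] b_def[symmetric] zexp[symmetric]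
    using G by (simp add: powr_def t_def)
qed

text \<open>
  The quadratic transformation with $p=\gamma+\frac12$ and $b=\alpha+2\gamma+1$ leads to the
  parameters $(\gamma+\frac12,\alpha+\gamma+\frac12)$ at $\xi$. Euler's transformation replaces
  them by $(\gamma+1,\alpha+\gamma+1)$, and its factor $(1-\xi)^{-1/2}$ cancels the square root of
  $(w+1)/(w-1)=1-\xi$ that the exponent $\beta=-\frac12$ contributes.
\<close>

lemma jacobi_Q_at_quadratic_even:
  fixes z l \<alpha> \<gamma> :: complex
  assumes z: "z \<notin> closed_segment (-1) 1" and l: "exp l = z - 1"
    and G: "Gamma (\<gamma> + 1/2) \<noteq> 0" "Gamma (\<alpha> + \<gamma> + 1) \<noteq> 0"
  shows "jacobi_Q_at l (2 * \<gamma>) \<alpha> \<alpha> z =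
            of_real (sqrt pi) * Gamma (\<alpha> + 2 * \<gamma> + 1) /
            (2 powr (2 * \<gamma>) * Gamma (\<gamma> + 1 / 2) * Gamma (\<alpha> + \<gamma> + 1)) *
            jacobi_Q_at (lift_quad l z) \<gamma> \<alpha> (- 1 / 2) (2 * z\<^sup>2 - 1)"
proof -
  define w where "w = 2 * z\<^sup>2 - 1"
  define b where "b = \<alpha> + 2 * \<gamma> + 1"
  define m where "m = log_succ l z"
  define t :: complex where "t = Ln 2"
  define s where "s = Ln ((w + 1) / (w - 1))"
  define X where "X = hyp2F1_olver (\<gamma> + 1/2) (\<alpha> + \<gamma> + 1/2) (b + 1/2) (2 / (1 - w))"
  have nz: "z \<noteq> 1" "z \<noteq> -1"
    using not_in_cut_neq[OF z] .
  have u: "(z + 1) / (z - 1) \<noteq> 0"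
    using nz by (auto simp: add_eq_0_iff2)
  have w: "w \<notin> closed_segment (-1) 1"
    using quadratic_in_cut[OF z] by (simp add: w_def)
  have wnz: "w \<noteq> 1" "(w + 1) / (w - 1) \<noteq> 0"
    using not_in_cut_neq[OF w] by (auto simp: add_eq_0_iff2)
  have ml: "m - l = Ln ((z + 1) / (z - 1))"
    by (simp add: m_def log_succ_def)
  have "hyp2F1_olver (2 * (\<gamma> + 1/2)) b (2 * b) (2 / (1 - z)) =
      of_real (sqrt pi) * 2 powr (1 - 2 * b) * rGamma b * exp (- (\<gamma> + 1/2) * (m - l)) * X"
    unfolding hyp2F1_olver_quadratic_double[OF jacobi_argument_in_slit_plane[OF z]]
      quadratic_argument[OF nz]
    unfolding one_minus_quotient[OF nz(1)] powr_def ml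
    using u by (simp add: X_def w_def b_def algebra_simps)
  then have "jacobi_Q_at l (2 * \<gamma>) \<alpha> \<alpha> z =
      exp ((2 * \<alpha> + 2 * \<gamma>) * t) * Gamma b * Gamma b / (exp (b * l) * exp (\<alpha> * m)) *
      (of_real (sqrt pi) * exp ((1 - 2 * b) * t) * rGamma b * exp (- (\<gamma> + 1/2) * (m - l)) * X)"
    by (simp add: jacobi_Q_at_def b_def m_def t_def powr_def algebra_simps)
  also have "\<dots> = of_real (sqrt pi) * (Gamma b * Gamma b * rGamma b) * X *
      (exp ((2 * \<alpha> + 2 * \<gamma>) * t) / (exp (b * l) * exp (\<alpha> * m)) * exp ((1 - 2 * b) * t) *
       exp (- (\<gamma> + 1/2) * (m - l)))"
    by simp
  also have "Gamma b * Gamma b * rGamma b = Gamma b"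
    by (cases "Gamma b = 0") (simp_all add: rGamma_inverse_Gamma)
  also have "exp ((2 * \<alpha> + 2 * \<gamma>) * t) / (exp (b * l) * exp (\<alpha> * m)) * exp ((1 - 2 * b) * t) *
       exp (- (\<gamma> + 1/2) * (m - l)) =
       exp (- (2 * \<gamma> + 1) * t - (\<alpha> + \<gamma> + 1/2) * (l + m))"
    unfolding exp_add[symmetric] exp_diff[symmetric]
    by (rule arg_cong[where f = exp]) (simp add: b_def field_simps)
  also have "\<dots> = exp ((\<alpha> - 1/2 + \<gamma>) * t) / (exp (2 * \<gamma> * t) *
      (exp ((\<alpha> + \<gamma> + 1) * (t + l + m)) * exp (- (1/2) * (t + l + m + s)))) * exp (- (1/2) * s)"
    unfolding exp_add[symmetric] exp_diff[symmetric]
    by (rule arg_cong[where f = exp]) (simp add: field_simps)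
  finally have "jacobi_Q_at l (2 * \<gamma>) \<alpha> \<alpha> z = of_real (sqrt pi) * Gamma b * X * \<dots>" .
  moreover have "jacobi_Q_at (lift_quad l z) \<gamma> \<alpha> (- 1/2) w =
      exp ((\<alpha> - 1/2 + \<gamma>) * t) * Gamma (\<alpha> + \<gamma> + 1) * Gamma (\<gamma> + 1/2) /
      (exp ((\<alpha> + \<gamma> + 1) * (t + l + m)) * exp (- (1/2) * (t + l + m + s))) * (exp (- (1/2) * s) * X)"
  proof -
    have "hyp2F1_olver (\<gamma> + 1) (\<alpha> + \<gamma> + 1) (b + 1/2) (2 / (1 - w)) =
        (1 - 2 / (1 - w)) powr (b + 1/2 - (\<gamma> + 1) - (\<alpha> + \<gamma> + 1)) * X"
      unfolding X_def
    proof (rule hyp2F1_olver_euler)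
      show "2 / (1 - w) \<in> slit_plane"
        by (rule jacobi_argument_in_slit_plane[OF w])
      have "b + 1/2 - (\<gamma> + 1) = \<alpha> + \<gamma> + 1/2" "b + 1/2 - (\<alpha> + \<gamma> + 1) = \<gamma> + 1/2"
        "(\<gamma> + 1/2) + (\<alpha> + \<gamma> + 1/2) + 1/2 = b + 1/2"
        by (simp_all add: b_def)
      then show "hyp2F1_olver (\<gamma> + 1/2) (\<alpha> + \<gamma> + 1/2) (b + 1/2) holomorphic_on slit_plane"
        "hyp2F1_olver (\<gamma> + 1/2) (\<alpha> + \<gamma> + 1/2) (b + 1/2) has_fps_expansion
          gauss_fps (b + 1/2 - (\<gamma> + 1)) (b + 1/2 - (\<alpha> + \<gamma> + 1)) (b + 1/2)"
        using hyp2F1_olver_half_holomorphic[of "\<gamma> + 1/2" "\<alpha> + \<gamma> + 1/2"]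
          hyp2F1_olver_half_has_fps_expansion[of "\<gamma> + 1/2" "\<alpha> + \<gamma> + 1/2"]
        by (simp_all only: gauss_fps_commute[of "\<gamma> + 1/2"])
    qed
    also have "b + 1/2 - (\<gamma> + 1) - (\<alpha> + \<gamma> + 1) = - (1/2)"
      by (simp add: b_def)
    also have "(1 - 2 / (1 - w)) powr (- (1/2)) = exp (- (1/2) * s)"
      unfolding one_minus_quotient[OF wnz(1)] using wnz(2) by (simp add: powr_def s_def)
    finally have hyp: "hyp2F1_olver (\<gamma> + 1) (\<alpha> + \<gamma> + 1) (b + 1/2) (2 / (1 - w)) = exp (- (1/2) * s) * X" .
    have "log_succ (lift_quad l z) w = t + l + m + s" "lift_quad l z = t + l + m"
      by (simp_all add: log_succ_def lift_quad_def t_def m_def s_def)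
    moreover have "\<alpha> + (- 1/2) + 2 * \<gamma> + 2 = b + 1/2" "- 1/2 + \<gamma> + 1 = \<gamma> + 1/2"
      by (simp_all add: b_def)
    ultimately show ?thesis
      unfolding jacobi_Q_at_def by (simp only: hyp powr_def t_def) simp
  qed
  ultimately show ?thesis
    unfolding w_def[symmetric] b_def[symmetric]
    using G by (simp add: powr_def t_def)
qed

text \<open>
  The principal branch at $z$ lifts to the principal branch at $w$, so the relation between
  principal values is the relation on the covers at the principal logarithm.
\<close>

lemma jacobi_Q_quadratic_principal:
  assumes z: "z \<notin> closed_segment (-1) 1" and Re: "Re z > 0 \<or> Re z = 0 \<and> Im z > 0"
    and at: "\<And>l. exp l = z - 1 \<Longrightarrow> jacobi_Q_at l \<delta> \<alpha> \<alpha> z =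
        C * jacobi_Q_at (lift_quad l z) \<gamma> \<alpha> \<beta> (2 * z\<^sup>2 - 1)"
  shows "jacobi_Q \<delta> \<alpha> \<alpha> z = C * jacobi_Q \<gamma> \<alpha> \<beta> (2 * z\<^sup>2 - 1)"
proof -
  have "exp (Ln (z - 1)) = z - 1"
    using not_in_cut_neq[OF z] by simp
  from at[OF this] show ?thesis
    unfolding jacobi_Q_at_Ln[OF z] lift_quad_Ln[OF z Re] jacobi_Q_at_Ln[OF quadratic_in_cut[OF z]] .
qed

lemma Gamma_neq_zero:
  fixes a :: complex
  assumes "\<And>n::nat. n \<ge> 1 \<Longrightarrow> a \<noteq> - of_nat n"
  shows "Gamma (a + 1) \<noteq> 0"
proof
  assume "Gamma (a + 1) = 0"
  then obtain k where "a + 1 = - of_nat k"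
    by (auto simp: Gamma_eq_zero_iff elim: nonpos_Ints_cases')
  then have "(a + 1) - 1 = - of_nat (k + 1)"
    by simp
  then have "a = - of_nat (k + 1)"
    by (simp only: add_diff_cancel_right')
  with assms[of "k + 1"] show False
    by simp
qed

theorem theorem2p21:
  fixes z \<gamma> \<alpha> :: complex
  assumes "z \<notin> closed_segment (-1) 1"
    and "\<forall>n::nat. n \<ge> 1 \<longrightarrow> \<alpha> + \<gamma> \<noteq> - of_nat n"
  shows
    "((\<forall>n::nat. n \<ge> 1 \<longrightarrow> \<alpha> + 2 * \<gamma> \<noteq> - of_nat n) \<and>
      (\<forall>n::nat. n \<ge> 1 \<longrightarrow> \<gamma> \<noteq> - of_nat n + 1 / 2) \<longrightarrow>
        (\<forall>l. exp l = z - 1 \<longrightarrow>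
          jacobi_Q_at l (2 * \<gamma>) \<alpha> \<alpha> z =
            of_real (sqrt pi) * Gamma (\<alpha> + 2 * \<gamma> + 1) /
            (2 powr (2 * \<gamma>) * Gamma (\<gamma> + 1 / 2) * Gamma (\<alpha> + \<gamma> + 1)) *
            jacobi_Q_at (lift_quad l z) \<gamma> \<alpha> (- 1 / 2) (2 * z\<^sup>2 - 1)) \<and>
        (Re z > 0 \<or> Re z = 0 \<and> Im z > 0 \<longrightarrow>
          jacobi_Q (2 * \<gamma>) \<alpha> \<alpha> z =
            of_real (sqrt pi) * Gamma (\<alpha> + 2 * \<gamma> + 1) /
            (2 powr (2 * \<gamma>) * Gamma (\<gamma> + 1 / 2) * Gamma (\<alpha> + \<gamma> + 1)) *
            jacobi_Q \<gamma> \<alpha> (- 1 / 2) (2 * z\<^sup>2 - 1)))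
     \<and>
     ((\<forall>n::nat. n \<ge> 1 \<longrightarrow> \<alpha> + 2 * \<gamma> + 1 \<noteq> - of_nat n) \<and>
      (\<forall>n::nat. n \<ge> 1 \<longrightarrow> \<gamma> \<noteq> - of_nat n - 1 / 2) \<longrightarrow>
        (\<forall>l. exp l = z - 1 \<longrightarrow>
          jacobi_Q_at l (2 * \<gamma> + 1) \<alpha> \<alpha> z =
            of_real (sqrt pi) * Gamma (\<alpha> + 2 * \<gamma> + 2) * z /
            (2 powr (2 * \<gamma> + 1) * Gamma (\<gamma> + 3 / 2) * Gamma (\<alpha> + \<gamma> + 1)) *
            jacobi_Q_at (lift_quad l z) \<gamma> \<alpha> (1 / 2) (2 * z\<^sup>2 - 1)) \<and>
        (Re z > 0 \<or> Re z = 0 \<and> Im z > 0 \<longrightarrow>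
          jacobi_Q (2 * \<gamma> + 1) \<alpha> \<alpha> z =
            of_real (sqrt pi) * Gamma (\<alpha> + 2 * \<gamma> + 2) * z /
            (2 powr (2 * \<gamma> + 1) * Gamma (\<gamma> + 3 / 2) * Gamma (\<alpha> + \<gamma> + 1)) *
            jacobi_Q \<gamma> \<alpha> (1 / 2) (2 * z\<^sup>2 - 1)))"
  proof -
  have G: "Gamma (\<alpha> + \<gamma> + 1) \<noteq> 0"
    using assms(2) by (intro Gamma_neq_zero) simp
  have G1: "Gamma (\<gamma> + 1/2) \<noteq> 0" if "\<forall>n::nat. n \<ge> 1 \<longrightarrow> \<gamma> \<noteq> - of_nat n + 1 / 2"
    using Gamma_neq_zero[of "\<gamma> - 1/2"] that by (simp add: diff_eq_eq add.commute)
  have G2: "Gamma (\<gamma> + 3/2) \<noteq> 0" if "\<forall>n::nat. n \<ge> 1 \<longrightarrow> \<gamma> \<noteq> - of_nat n - 1 / 2"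
    using Gamma_neq_zero[of "\<gamma> + 1/2"] that by (simp add: eq_diff_eq add.commute)
  show ?thesis
  proof (intro conjI impI allI, goal_cases)
    case (1 l)
    then show ?case
      using jacobi_Q_at_quadratic_even[OF assms(1) _ G1 G] by blast
  next
    case 2
    then show ?case
      using jacobi_Q_at_quadratic_even[OF assms(1) _ G1 G]
      by (intro jacobi_Q_quadratic_principal[OF assms(1)]) blast+
  next
    case (3 l)
    then show ?case
      using jacobi_Q_at_quadratic_odd[OF assms(1) _ G2 G] by blast
  next
    case 4
    then show ?case
      using jacobi_Q_at_quadratic_odd[OF assms(1) _ G2 G]
      by (intro jacobi_Q_quadratic_principal[OF assms(1)]) blast+
  qed
qed

end
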